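(* Let $f\colon\omega\to\omega$ be a unary total computable function with finite range. If $f$ is not intrinsically computable on $(\omega,<)$, then the degree spectrum of $f$ on $(\omega,<)$ is equal to the set of all $\Delta_2$ Turing degrees.
   Context: A computable copy of $(\omega,<)$ is a structure $(\omega,\prec)$ with $\prec$ a computable ordering on $\omega$ such that $(\omega,\prec)\cong(\omega,<)$. For a computable copy $\mathcal A$, $f_{\mathcal A}$ denotes the image of the graph of $f$ under the isomorphism from $(\omega,<)$ onto $\mathcal A$. The degree spectrum of $f$ is the set of Turing degrees of $f_{\mathcal A}$ over all computable copies $\mathcal A$ of $(\omega,<)$; $f$ is intrinsically computable if its spectrum contains only the computable degree. *)

theory Defs
  imports Main "HOL-Library.Nat_Bijection"
begin

(* Partial recursive functions relative to an oracle set.  Programs carry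
   no arity annotation: eval determines on which argument lists a program is
   defined, and a program may be defined for several arities. *)

datatype prog =
    Zero
  | Succ
  | Proj nat
  | Query
  | Comp prog "prog list"
  | Prim_Rec prog prog
  | Minimize prog

(* eval A p xs y: program p with oracle A halts on input xs with output y. *)

inductive eval :: "nat set \<Rightarrow> prog \<Rightarrow> nat list \<Rightarrow> nat \<Rightarrow> bool" for A :: "nat set" where
  eval_Zero: "eval A Zero xs 0"
| eval_Succ: "eval A Succ [x] (Suc x)"
| eval_Proj: "i < length xs \<Longrightarrow> eval A (Proj i) xs (xs ! i)"
| eval_Query: "eval A Query [x] (of_bool (x \<in> A))"
| eval_Comp: "\<lbrakk>list_all2 (\<lambda>g y. eval A g xs y) gs ys; eval A h ys z\<rbrakk>
    \<Longrightarrow> eval A (Comp h gs) xs z"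
| eval_Prim_Rec_0: "eval A g xs z \<Longrightarrow> eval A (Prim_Rec g h) (0 # xs) z"
| eval_Prim_Rec_Suc: "\<lbrakk>eval A (Prim_Rec g h) (n # xs) y; eval A h (y # n # xs) z\<rbrakk>
    \<Longrightarrow> eval A (Prim_Rec g h) (Suc n # xs) z"
| eval_Minimize: "\<lbrakk>\<forall>m<n. \<exists>k. eval A g (m # xs) (Suc k); eval A g (n # xs) 0\<rbrakk>
    \<Longrightarrow> eval A (Minimize g) xs n"

lemma eval_deterministic: "eval A p xs y \<Longrightarrow> eval A p xs z \<Longrightarrow> y = z"
proof (induction arbitrary: z rule: eval.induct)
  case (eval_Zero xs)
  then show ?case by cases auto
next
  case (eval_Succ x)
  then show ?case by cases auto
next
  case (eval_Proj i xs)
  from eval_Proj.prems show ?case by cases auto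
next
  case (eval_Query x)
  then show ?case by cases auto
next
  case (eval_Comp xs gs ys h y)
  from eval_Comp.prems show ?case
  proof cases
    case (eval_Comp ys')
    have "ys = ys'"
      using eval_Comp.IH(1) eval_Comp(1)
      by (auto simp: list_all2_conv_all_nth intro!: nth_equalityI)
    then show ?thesis using eval_Comp.IH(2) eval_Comp(2) by simp
  qed
next
  case (eval_Prim_Rec_0 g xs y h)
  from eval_Prim_Rec_0.prems show ?case by cases (auto intro: eval_Prim_Rec_0.IH)
next
  case (eval_Prim_Rec_Suc g h n xs y w)
  from eval_Prim_Rec_Suc.prems show ?case
    by cases (use eval_Prim_Rec_Suc.IH in blast)
next
  case (eval_Minimize n g xs)
  from eval_Minimize.prems show ?case
  proof cases
    case eval_Minimize': eval_Minimize
    have "\<not> n < z"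
      using eval_Minimize' eval_Minimize.IH(2) by (metis nat.distinct(1))
    moreover have "\<not> z < n"
      using eval_Minimize' eval_Minimize.IH(1) by (metis nat.distinct(1))
    ultimately show ?thesis by simp
  qed
qed

(* Computability without an oracle is computability relative to the empty set. *)

definition computable_fun :: "(nat \<Rightarrow> nat) \<Rightarrow> bool" where
  "computable_fun f \<longleftrightarrow> (\<exists>p. \<forall>x. eval {} p [x] (f x))"

definition computable_rel2 :: "(nat \<Rightarrow> nat \<Rightarrow> bool) \<Rightarrow> bool" where
  "computable_rel2 R \<longleftrightarrow> (\<exists>p. \<forall>x y. eval {} p [x, y] (of_bool (R x y)))"

definition computable_rel3 :: "(nat \<Rightarrow> nat \<Rightarrow> nat \<Rightarrow> bool) \<Rightarrow> bool" where
  "computable_rel3 R \<longleftrightarrow> (\<exists>p. \<forall>x y z. eval {} p [x, y, z] (of_bool (R x y z)))"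

definition turing_reducible :: "nat set \<Rightarrow> nat set \<Rightarrow> bool" (infix "\<le>\<^sub>T" 50) where
  "A \<le>\<^sub>T B \<longleftrightarrow> (\<exists>p. \<forall>x. eval B p [x] (of_bool (x \<in> A)))"

definition turing_equiv :: "nat set \<Rightarrow> nat set \<Rightarrow> bool" (infix "\<equiv>\<^sub>T" 50) where
  "A \<equiv>\<^sub>T B \<longleftrightarrow> A \<le>\<^sub>T B \<and> B \<le>\<^sub>T A"

definition turing_degree :: "nat set \<Rightarrow> nat set set" where
  "turing_degree A = {B. B \<equiv>\<^sub>T A}"

primrec subst_query :: "prog \<Rightarrow> prog \<Rightarrow> prog" where
  "subst_query q Zero = Zero"
| "subst_query q Succ = Succ"
| "subst_query q (Proj i) = Proj i"
| "subst_query q Query = q"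
| "subst_query q (Comp h gs) = Comp (subst_query q h) (map (subst_query q) gs)"
| "subst_query q (Prim_Rec g h) = Prim_Rec (subst_query q g) (subst_query q h)"
| "subst_query q (Minimize g) = Minimize (subst_query q g)"

lemma eval_subst_query:
  assumes "\<forall>x. eval B q [x] (of_bool (x \<in> A))"
  shows "eval A p xs y \<Longrightarrow> eval B (subst_query q p) xs y"
proof (induction rule: eval.induct)
  case (eval_Comp xs gs ys h z)
  then show ?case
    by (auto simp: list_all2_conv_all_nth intro!: eval.eval_Comp)
next
  case (eval_Minimize n g xs)
  then show ?case by (auto intro!: eval.eval_Minimize)
qed (use assms in \<open>auto intro: eval.intros\<close>)

lemma turing_reducible_refl: "A \<le>\<^sub>T A"
  unfolding turing_reducible_def using eval_Query by blast

lemma turing_reducible_trans: "A \<le>\<^sub>T B \<Longrightarrow> B \<le>\<^sub>T C \<Longrightarrow> A \<le>\<^sub>T C"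
  unfolding turing_reducible_def using eval_subst_query by metis

lemma turing_degree_eq_iff: "turing_degree A = turing_degree B \<longleftrightarrow> A \<equiv>\<^sub>T B"
  unfolding turing_degree_def turing_equiv_def
  using turing_reducible_refl turing_reducible_trans by blast

definition computable_degree :: "nat set set" where
  "computable_degree = turing_degree {}"

definition Sigma2 :: "nat set \<Rightarrow> bool" where
  "Sigma2 A \<longleftrightarrow> (\<exists>R. computable_rel3 R \<and> A = {x. \<exists>y. \<forall>z. R x y z})"

definition Pi2 :: "nat set \<Rightarrow> bool" where
  "Pi2 A \<longleftrightarrow> (\<exists>R. computable_rel3 R \<and> A = {x. \<forall>y. \<exists>z. R x y z})"

definition Delta2 :: "nat set \<Rightarrow> bool" where
  "Delta2 A \<longleftrightarrow> Sigma2 A \<and> Pi2 A"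

definition Delta2_degrees :: "nat set set set" where
  "Delta2_degrees = {turing_degree A | A. Delta2 A}"

definition omega_iso :: "(nat \<Rightarrow> nat) \<Rightarrow> (nat \<Rightarrow> nat \<Rightarrow> bool) \<Rightarrow> bool" where
  "omega_iso \<phi> R \<longleftrightarrow> bij \<phi> \<and> (\<forall>m n. m < n \<longleftrightarrow> R (\<phi> m) (\<phi> n))"

(* Being a strict linear ordering of all of nat is implied by the isomorphism. *)

definition computable_copy :: "(nat \<Rightarrow> nat \<Rightarrow> bool) \<Rightarrow> bool" where
  "computable_copy R \<longleftrightarrow> computable_rel2 R \<and> (\<exists>\<phi>. omega_iso \<phi> R)"

lemma omega_iso_unique:
  assumes "omega_iso \<phi> R" "omega_iso \<psi> R"
  shows "\<phi> = \<psi>"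
proof
  fix n
  have bij: "bij \<phi>" "bij \<psi>" using assms by (auto simp: omega_iso_def)
  show "\<phi> n = \<psi> n"
  proof (induction n rule: less_induct)
    case (less n)
    obtain k where k: "\<psi> k = \<phi> n" using bij(2) by (metis bij_pointE)
    obtain l where l: "\<phi> l = \<psi> n" using bij(1) by (metis bij_pointE)
    have "\<not> k < n"
      using less k bij by (metis bij_pointE nat_neq_iff)
    moreover have "\<not> l < n"
      using less l bij by (metis bij_pointE nat_neq_iff)
    moreover have "\<not> (n < k \<and> n < l)"
      using assms k l unfolding omega_iso_def by (metis order.asym)
    ultimately have "k = n \<or> l = n" by linarith
    then show ?case using k l by auto
  qed
qed

(* The isomorphism from (nat, <) onto R is unique by omega_iso_unique. *)

definition copy_iso :: "(nat \<Rightarrow> nat \<Rightarrow> bool) \<Rightarrow> nat \<Rightarrow> nat" where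
  "copy_iso R = (THE \<phi>. omega_iso \<phi> R)"

lemma copy_iso_eq: "omega_iso \<phi> R \<Longrightarrow> copy_iso R = \<phi>"
  unfolding copy_iso_def using omega_iso_unique by blast

definition fun_graph :: "(nat \<Rightarrow> nat) \<Rightarrow> (nat \<times> nat) set" where
  "fun_graph f = {(x, f x) | x. True}"

definition graph_in_copy :: "(nat \<Rightarrow> nat) \<Rightarrow> (nat \<Rightarrow> nat \<Rightarrow> bool) \<Rightarrow> (nat \<times> nat) set" where
  "graph_in_copy f R = map_prod (copy_iso R) (copy_iso R) ` fun_graph f"

(* The degree of a binary relation is that of its set of codes under the
   (computable) Cantor pairing function. *)

definition degree_spectrum :: "(nat \<Rightarrow> nat) \<Rightarrow> nat set set set" where
  "degree_spectrum f =
     {turing_degree (prod_encode ` graph_in_copy f R) | R. computable_copy R}"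

definition intrinsically_computable :: "(nat \<Rightarrow> nat) \<Rightarrow> bool" where
  "intrinsically_computable f \<longleftrightarrow> degree_spectrum f = {computable_degree}"

end

theory Submission imports Defs begin

text \<open>In a computable copy the number of predecessors of \<open>x\<close> seen by stage \<open>s\<close> converges, so the
  image of the graph is a limit of computable approximations and hence \<open>\<Delta>\<^sub>2\<close>.

  Conversely, since the range is finite, the image of the graph amounts to the colouring of the copy
  by the values of \<open>f\<close>. If \<open>f\<close> is not eventually constant then two colours \<open>c\<close> and \<open>d\<close> recur, and
  beyond some position every colour recurs. Given \<open>D = lim h\<close>, build a copy in stages with coding
  elements \<open>a\<^sub>0, a\<^sub>1, \<dots>\<close>, where \<open>a\<^sub>j\<close> has colour \<open>c\<close> if \<open>j \<in> D\<close> and \<open>d\<close> otherwise. When the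
  approximation to \<open>D\<close> changes at \<open>j\<close>, new elements are inserted to push \<open>a\<^sub>j\<close> to a position of the
  right colour, and likewise the elements above it to restore their colours. A new non-coding element
  keeps for ever the colour of the position where it was inserted, so the whole colouring is computable
  from \<open>D\<close>. An element moves only when the approximation changes at one of the finitely many coding
  elements up to it, so it has finitely many predecessors in the limit.\<close>

subsection \<open>Programs for the pairing function\<close>

lemma eval_Comp1:
  "eval A g xs y \<Longrightarrow> eval A h [y] z \<Longrightarrow> eval A (Comp h [g]) xs z"
  by (rule eval_Comp[where ys = "[y]"]) auto

lemma eval_Comp2:
  "eval A g xs y \<Longrightarrow> eval A g' xs y' \<Longrightarrow> eval A h [y, y'] z \<Longrightarrow> eval A (Comp h [g, g']) xs z"
  by (rule eval_Comp[where ys = "[y, y']"]) auto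

lemma eval_Comp3:
  "eval A g xs y \<Longrightarrow> eval A g' xs y' \<Longrightarrow> eval A g'' xs y'' \<Longrightarrow> eval A h [y, y', y''] z \<Longrightarrow>
    eval A (Comp h [g, g', g'']) xs z"
  by (rule eval_Comp[where ys = "[y, y', y'']"]) auto

lemma eval_Proj_0: "eval A (Proj 0) (x # xs) x"
  using eval_Proj[of 0 "x # xs" A] by simp

lemma eval_Proj_1: "eval A (Proj (Suc 0)) (x # y # xs) y"
  using eval_Proj[of "Suc 0" "x # y # xs" A] by simp

lemma eval_Proj_2: "eval A (Proj 2) (x # y # z # xs) z"
  using eval_Proj[of 2 "x # y # z # xs" A] by simp

lemmas eval_basic = eval_Comp1 eval_Comp2 eval_Comp3 eval_Proj_0 eval_Proj_1 eval_Proj_2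
  eval_Succ eval_Zero

primrec const_prog :: "nat \<Rightarrow> prog" where
  "const_prog 0 = Zero"
| "const_prog (Suc n) = Comp Succ [const_prog n]"

lemma eval_const_prog: "eval A (const_prog n) xs n"
  by (induction n) (auto intro: eval_basic)

definition add_prog :: prog where
  "add_prog = Prim_Rec (Proj 0) (Comp Succ [Proj 0])"

lemma eval_add_prog: "eval A add_prog [m, n] (m + n)"
proof (induction m)
  case 0
  then show ?case by (auto simp: add_prog_def intro: eval_Prim_Rec_0 eval_Proj_0)
next
  case (Suc m)
  have "eval A (Comp Succ [Proj 0]) [m + n, m, n] (Suc m + n)"
    using eval_Comp1[OF eval_Proj_0 eval_Succ] by simp
  then show ?case
    using Suc unfolding add_prog_def by (blast intro: eval_Prim_Rec_Suc)
qed

definition pred_prog :: prog where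
  "pred_prog = Prim_Rec Zero (Proj (Suc 0))"

lemma eval_pred_prog: "eval A pred_prog [n] (n - 1)"
proof (induction n)
  case 0
  then show ?case by (auto simp: pred_prog_def intro: eval_Prim_Rec_0 eval_Zero)
next
  case (Suc n)
  then show ?case
    using eval_Proj_1[of A "n - 1" n "[]"] unfolding pred_prog_def
    by (auto intro: eval_Prim_Rec_Suc)
qed

text \<open>\<open>Prim_Rec\<close> recurses on its first argument, so the arguments are swapped and
  the predecessor is iterated as often as the subtrahend says.\<close>

definition sub_prog :: prog where
  "sub_prog = Comp (Prim_Rec (Proj 0) (Comp pred_prog [Proj 0])) [Proj (Suc 0), Proj 0]"

lemma eval_sub_prog: "eval A sub_prog [m, n] (m - n)"
proof -
  have "eval A (Prim_Rec (Proj 0) (Comp pred_prog [Proj 0])) [n, m] (m - n)"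
  proof (induction n)
    case 0
    then show ?case by (auto intro: eval_Prim_Rec_0 eval_Proj_0)
  next
    case (Suc n)
    have "eval A (Comp pred_prog [Proj 0]) [m - n, n, m] (m - n - 1)"
      by (rule eval_Comp1 eval_Proj_0 eval_pred_prog)+
    then show ?case using Suc by (auto intro: eval_Prim_Rec_Suc)
  qed
  then show ?thesis
    unfolding sub_prog_def by (blast intro: eval_basic)
qed

definition triangle_prog :: prog where
  "triangle_prog = Prim_Rec Zero (Comp add_prog [Proj 0, Comp Succ [Proj (Suc 0)]])"

lemma eval_triangle_prog: "eval A triangle_prog [n] (triangle n)"
proof (induction n)
  case 0
  then show ?case by (auto simp: triangle_prog_def intro: eval_Prim_Rec_0 eval_Zero)
next
  case (Suc n)
  have "eval A (Comp add_prog [Proj 0, Comp Succ [Proj (Suc 0)]]) [triangle n, n] (triangle (Suc n))"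
    unfolding triangle_Suc by (rule eval_basic eval_add_prog)+
  then show ?case using Suc unfolding triangle_prog_def by (blast intro: eval_Prim_Rec_Suc)
qed

definition pair_prog :: prog where
  "pair_prog = Comp add_prog [Comp triangle_prog [add_prog], Proj 0]"

lemma eval_pair_prog: "eval A pair_prog [m, n] (prod_encode (m, n))"
  unfolding pair_prog_def prod_encode_def prod.case
  by (rule eval_basic eval_add_prog eval_triangle_prog)+

text \<open>The largest \<^term>\<open>s\<close> with \<^term>\<open>triangle s \<le> n\<close>; it is the sum of the two components.\<close>

definition diag_prog :: prog where
  "diag_prog = Minimize (Comp sub_prog [Comp Succ [Proj (Suc 0)], Comp triangle_prog [Comp Succ [Proj 0]]])"

lemma eval_diag_prog: "eval A diag_prog [prod_encode (a, b)] (a + b)"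
proof -
  \<comment> \<open>The truncated difference is \<open>0\<close> exactly when
    \<open>x < triangle (Suc m)\<close>, so the search stops at the diagonal containing
    \<open>x\<close>.\<close>
  let ?g = "Comp sub_prog [Comp Succ [Proj (Suc 0)], Comp triangle_prog [Comp Succ [Proj 0]]]"
  have g: "eval A ?g [m, x] (Suc x - triangle (Suc m))" for m x
    by (rule eval_basic eval_sub_prog eval_triangle_prog)+
  have mono: "triangle m \<le> triangle n" if "m \<le> n" for m n
    using that by (rule lift_Suc_mono_le[rotated]) simp
  have "\<exists>k. eval A ?g [m, prod_encode (a, b)] (Suc k)" if "m < a + b" for m
  proof -
    have "triangle (Suc m) \<le> prod_encode (a, b)"
      using mono[of "Suc m" "a + b"] that by (simp add: prod_encode_def)
    then show ?thesis using g[of m "prod_encode (a, b)"] Suc_diff_le by metis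
  qed
  moreover have "eval A ?g [a + b, prod_encode (a, b)] 0"
    using g[of "a + b" "prod_encode (a, b)"] by (simp add: prod_encode_def)
  ultimately show ?thesis unfolding diag_prog_def by (blast intro: eval_Minimize)
qed

definition fst_prog :: prog where
  "fst_prog = Comp sub_prog [Proj 0, Comp triangle_prog [diag_prog]]"

definition snd_prog :: prog where
  "snd_prog = Comp sub_prog [diag_prog, fst_prog]"

lemma eval_fst_prog: "eval A fst_prog [prod_encode (a, b)] a"
proof -
  have "eval A fst_prog [prod_encode (a, b)] (prod_encode (a, b) - triangle (a + b))"
    unfolding fst_prog_def
    by (rule eval_basic eval_sub_prog eval_triangle_prog eval_diag_prog)+
  then show ?thesis by (simp add: prod_encode_def)
qed

lemma eval_snd_prog: "eval A snd_prog [prod_encode (a, b)] b"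
proof -
  have "eval A snd_prog [prod_encode (a, b)] (a + b - a)"
    unfolding snd_prog_def
    by (rule eval_basic eval_sub_prog eval_fst_prog eval_diag_prog)+
  then show ?thesis by simp
qed

subsection \<open>Recursive functions between coded types\<close>

class code =
  fixes code :: "'a \<Rightarrow> nat"
  assumes inj_code: "inj code"

lemma code_eq_iff: "code x = code y \<longleftrightarrow> x = y"
  using inj_code by (auto dest: injD)

instantiation nat :: code
begin
definition code_nat :: "nat \<Rightarrow> nat" where [simp]: "code_nat n = n"
instance by standard (simp add: inj_def)
end

instantiation bool :: code
begin
definition code_bool :: "bool \<Rightarrow> nat" where [simp]: "code_bool b = of_bool b"
instance by standard (auto simp: inj_def split: if_splits)
end

instantiation prod :: (code, code) code
begin
definition code_prod :: "'a \<times> 'b \<Rightarrow> nat" where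
  "code_prod z = prod_encode (code (fst z), code (snd z))"
instance by standard (auto simp: inj_def code_prod_def code_eq_iff)
end

instantiation list :: (code) code
begin
definition code_list :: "'a list \<Rightarrow> nat" where
  "code_list xs = list_encode (map code xs)"
instance
proof
  have "inj (map code :: 'a list \<Rightarrow> _)" using inj_code by (rule inj_mapI)
  then show "inj (code :: 'a list \<Rightarrow> _)"
    unfolding code_list_def inj_def by (metis list_encode_inverse)
qed
end

text \<open>Several arguments are passed as one tuple, so a single arity suffices. On numbers that
  are not codes the program is unconstrained.\<close>

definition recursive :: "nat set \<Rightarrow> ('a::code \<Rightarrow> 'b::code) \<Rightarrow> bool" where
  "recursive A f \<longleftrightarrow> (\<exists>p. \<forall>x. eval A p [code x] (code (f x)))"

named_theorems recursive_intros

lemma recursiveI: "(\<And>x. eval A p [code x] (code (f x))) \<Longrightarrow> recursive A f"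
  unfolding recursive_def by blast

lemma recursiveE:
  assumes "recursive A f"
  obtains p where "\<forall>x. eval A p [code x] (code (f x))"
  using assms unfolding recursive_def by blast

text \<open>Relative to the empty set every query is answered \<open>0\<close>, so
  \<open>Query\<close> can be replaced by \<open>Zero\<close>.\<close>

lemma recursive_oracle_empty: "recursive {} f \<Longrightarrow> recursive A f"
  unfolding recursive_def using eval_subst_query[of A Zero "{}"] eval_Zero
  by (metis empty_iff of_bool_eq(1))

lemma recursive_member_oracle: "recursive A (\<lambda>x. x \<in> A)"
  by (rule recursiveI[where p = Query]) (simp only: code_nat_def code_bool_def eval_Query)

lemma recursive_id [recursive_intros]: "recursive A (\<lambda>x. x)"
  by (rule recursiveI[where p = "Proj 0"]) (rule eval_Proj_0)

lemma recursive_const [recursive_intros]: "recursive A (\<lambda>x. c)"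
  by (rule recursiveI) (rule eval_const_prog)

lemma recursive_compose:
  assumes "recursive A g" "recursive A f"
  shows "recursive A (\<lambda>x. g (f x))"
proof -
  obtain p where "\<forall>x. eval A p [code x] (code (f x))" using assms(2) by (rule recursiveE)
  moreover obtain q where "\<forall>y. eval A q [code y] (code (g y))" using assms(1) by (rule recursiveE)
  ultimately show ?thesis by (auto intro: recursiveI[where p = "Comp q [p]"] eval_Comp1)
qed

text \<open>Lifts a function on codes, which must be total even where its argument is not a code.\<close>

lemma recursive_via_code:
  assumes "recursive A F" "recursive A f" "\<And>x. code (g x) = F (code (f x))"
  shows "recursive A g"
  using recursive_compose[OF assms(1), of "\<lambda>x. code (f x)"] assms(2,3)
  unfolding recursive_def by simp

lemma recursive_Pair [recursive_intros]:
  assumes "recursive A f" "recursive A g"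
  shows "recursive A (\<lambda>x. (f x, g x))"
proof -
  obtain p where "\<forall>x. eval A p [code x] (code (f x))" using assms(1) by (rule recursiveE)
  moreover obtain q where "\<forall>x. eval A q [code x] (code (g x))" using assms(2) by (rule recursiveE)
  ultimately show ?thesis
    by (auto intro!: recursiveI[where p = "Comp pair_prog [p, q]"] eval_Comp2 eval_pair_prog
        simp: code_prod_def)
qed

lemma recursive_fst [recursive_intros]:
  "recursive A f \<Longrightarrow> recursive A (\<lambda>x. fst (f x))"
  by (rule recursive_compose[where g = fst])
    (auto intro!: recursiveI[where p = fst_prog] eval_fst_prog simp: code_prod_def)

lemma recursive_snd [recursive_intros]:
  "recursive A f \<Longrightarrow> recursive A (\<lambda>x. snd (f x))"
  by (rule recursive_compose[where g = snd])
    (auto intro!: recursiveI[where p = snd_prog] eval_snd_prog simp: code_prod_def)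

lemma recursive_compose2:
  assumes "recursive A (\<lambda>z. h (fst z) (snd z))" "recursive A f" "recursive A g"
  shows "recursive A (\<lambda>x. h (f x) (g x))"
  using recursive_compose[OF assms(1) recursive_Pair[OF assms(2,3)]] by simp

lemma recursive_Suc [recursive_intros]:
  "recursive A f \<Longrightarrow> recursive A (\<lambda>x. Suc (f x))"
  by (rule recursive_compose[where g = Suc])
    (auto intro!: recursiveI[where p = Succ] eval_Succ)

lemma recursive_rec_nat [recursive_intros]:
  fixes h :: "'a::code \<Rightarrow> nat \<Rightarrow> 'b::code \<Rightarrow> 'b"
  assumes g: "recursive A g"
    and h: "recursive A (\<lambda>z. h (fst z) (fst (snd z)) (snd (snd z)))"
    and k: "recursive A k"
  shows "recursive A (\<lambda>x. rec_nat (g x) (h x) (k x))"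
proof -
  obtain p where p: "\<forall>x. eval A p [code x] (code (g x))" using g by (rule recursiveE)
  obtain r where r: "\<forall>x. eval A r [code x] (code (k x))" using k by (rule recursiveE)
  obtain q where q: "\<forall>z. eval A q [code z] (code (h (fst z) (fst (snd z)) (snd (snd z))))"
    using h by (rule recursiveE)
  \<comment> \<open>\<open>Prim_Rec\<close> supplies value, counter and parameter in this order;
    \<open>?q\<close> repacks them as the code of \<open>(x, n, y)\<close>.\<close>
  let ?q = "Comp q [Comp pair_prog [Proj 2, Comp pair_prog [Proj (Suc 0), Proj 0]]]"
  have step: "eval A ?q [code y, n, code x] (code (h x n y))" for x n y
    using q[rule_format, of "(x, n, y)"] by (auto simp: code_prod_def intro!: eval_basic eval_pair_prog)
  have "eval A (Prim_Rec p ?q) [n, code x] (code (rec_nat (g x) (h x) n))" for n x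
  proof (induction n)
    case 0
    then show ?case using p by (auto intro: eval_Prim_Rec_0)
  next
    case (Suc n)
    then show ?case using step by (auto intro: eval_Prim_Rec_Suc)
  qed
  then have "eval A (Comp (Prim_Rec p ?q) [r, Proj 0]) [code x] (code (rec_nat (g x) (h x) (k x)))"
    for x using r[rule_format, of x] by (auto intro!: eval_Comp2[OF _ eval_Proj_0])
  then show ?thesis by (rule recursiveI)
qed

section \<open>Conditionals, connectives, arithmetic, search and finite tables\<close>

lemma recursive_of_bool [recursive_intros]:
  "recursive A P \<Longrightarrow> recursive A (\<lambda>x. of_bool (P x) :: nat)"
  unfolding recursive_def by simp

lemma recursive_If [recursive_intros]:
  assumes "recursive A P" "recursive A f" "recursive A g"
  shows "recursive A (\<lambda>x. if P x then f x else g x)"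
proof -
  have "recursive A (\<lambda>x. rec_nat (g x) (\<lambda>_ _. f x) (of_bool (P x)))"
    by (intro recursive_intros recursive_compose[OF assms(2)] assms(1,3))
  moreover have "(\<lambda>x. rec_nat (g x) (\<lambda>_ _. f x) (of_bool (P x))) = (\<lambda>x. if P x then f x else g x)"
    by auto
  ultimately show ?thesis by simp
qed

lemma recursive_not [recursive_intros]:
  assumes "recursive A P"
  shows "recursive A (\<lambda>x. \<not> P x)"
proof -
  have "recursive A (\<lambda>x. if P x then False else True)"
    by (intro recursive_If recursive_const assms)
  moreover have "(\<lambda>x. if P x then False else True) = (\<lambda>x. \<not> P x)" by auto
  ultimately show ?thesis by simp
qed

lemma recursive_conj [recursive_intros]:
  assumes "recursive A P" "recursive A Q"
  shows "recursive A (\<lambda>x. P x \<and> Q x)"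
proof -
  have "recursive A (\<lambda>x. if P x then Q x else False)"
    by (intro recursive_If recursive_const assms)
  moreover have "(\<lambda>x. if P x then Q x else False) = (\<lambda>x. P x \<and> Q x)" by auto
  ultimately show ?thesis by simp
qed

lemma recursive_disj [recursive_intros]:
  assumes "recursive A P" "recursive A Q"
  shows "recursive A (\<lambda>x. P x \<or> Q x)"
proof -
  have "recursive A (\<lambda>x. \<not> (\<not> P x \<and> \<not> Q x))"
    by (intro recursive_not recursive_conj assms)
  then show ?thesis by simp
qed

lemma recursive_imp [recursive_intros]:
  "recursive A P \<Longrightarrow> recursive A Q \<Longrightarrow> recursive A (\<lambda>x. P x \<longrightarrow> Q x)"
  using recursive_disj[OF recursive_not, of A P Q] by simp

lemma recursive_add [recursive_intros]:
  fixes f g :: "'a::code \<Rightarrow> nat"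
  assumes "recursive A f" "recursive A g"
  shows "recursive A (\<lambda>x. f x + g x)"
  by (rule recursive_compose2[OF _ assms])
    (auto intro!: recursiveI[where p = "Comp add_prog [fst_prog, snd_prog]"]
      eval_basic eval_fst_prog eval_snd_prog eval_add_prog simp: code_prod_def)

lemma recursive_diff [recursive_intros]:
  fixes f g :: "'a::code \<Rightarrow> nat"
  assumes "recursive A f" "recursive A g"
  shows "recursive A (\<lambda>x. f x - g x)"
  by (rule recursive_compose2[OF _ assms])
    (auto intro!: recursiveI[where p = "Comp sub_prog [fst_prog, snd_prog]"]
      eval_basic eval_fst_prog eval_snd_prog eval_sub_prog simp: code_prod_def)

lemma recursive_le [recursive_intros]:
  fixes f g :: "'a::code \<Rightarrow> nat"
  assumes "recursive A f" "recursive A g"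
  shows "recursive A (\<lambda>x. f x \<le> g x)"
proof -
  have "recursive A (\<lambda>x. rec_nat True (\<lambda>_ _. False) (f x - g x))"
    by (intro recursive_intros assms)
  moreover have "rec_nat True (\<lambda>_ _. False) (m - n) \<longleftrightarrow> m \<le> n" for m n :: nat
    by (cases "m - n") auto
  ultimately show ?thesis by simp
qed

lemma recursive_less [recursive_intros]:
  fixes f g :: "'a::code \<Rightarrow> nat"
  assumes "recursive A f" "recursive A g"
  shows "recursive A (\<lambda>x. f x < g x)"
  using recursive_not[OF recursive_le[OF assms(2,1)]] by (simp add: not_le)

text \<open>Coding is injective, so equality can be tested on the codes, as two inequalities of
  numbers.\<close>

lemma recursive_eq [recursive_intros]:
  assumes "recursive A f" "recursive A g"
  shows "recursive A (\<lambda>x. f x = g x)"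
proof -
  have "recursive A (\<lambda>x. code (f x))" "recursive A (\<lambda>x. code (g x))"
    using assms unfolding recursive_def by simp_all
  then have "recursive A (\<lambda>x. code (f x) \<le> code (g x) \<and> code (g x) \<le> code (f x))"
    by (intro recursive_intros)
  moreover have "code (f x) \<le> code (g x) \<and> code (g x) \<le> code (f x) \<longleftrightarrow> f x = g x" for x
    by (metis code_eq_iff order_antisym_conv order_refl)
  ultimately show ?thesis by simp
qed

lemma recursive_Least [recursive_intros]:
  assumes P: "recursive A (\<lambda>z. P (fst z) (snd z))" and ex: "\<And>x. \<exists>n::nat. P x n"
  shows "recursive A (\<lambda>x. LEAST n. P x n)"
proof -
  \<comment> \<open>\<open>Minimize\<close> looks for the value \<open>0\<close>, hence the
    negation.\<close>
  obtain p where p: "\<forall>z. eval A p [code z] (code (\<not> P (fst z) (snd z)))"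
    using recursive_not[OF P] by (rule recursiveE)
  let ?q = "Comp p [Comp pair_prog [Proj (Suc 0), Proj 0]]"
  have q: "eval A ?q [n, code x] (of_bool (\<not> P x n))" for n x
    using p[rule_format, of "(x, n)"] by (auto simp: code_prod_def intro!: eval_basic eval_pair_prog)
  have "eval A (Minimize ?q) [code x] (LEAST n. P x n)" for x
  proof (rule eval_Minimize)
    have "eval A ?q [m, code x] (Suc 0)" if "m < (LEAST n. P x n)" for m
      using q[of m x] not_less_Least[OF that] by simp
    then show "\<forall>m<LEAST n. P x n. \<exists>k. eval A ?q [m, code x] (Suc k)" by blast
    show "eval A ?q [LEAST n. P x n, code x] 0"
      using q[of "LEAST n. P x n" x] LeastI_ex[OF ex, of x] by simp
  qed
  then show ?thesis by (intro recursiveI[where p = "Minimize ?q"]) simp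
qed

lemma recursive_ball_less [recursive_intros]:
  fixes k :: "'a::code \<Rightarrow> nat"
  assumes "recursive A (\<lambda>z. P (fst z) (snd z))" and "recursive A k"
  shows "recursive A (\<lambda>x. \<forall>n<k x. P x n)"
proof -
  have "recursive A (\<lambda>x. rec_nat True (\<lambda>n r. r \<and> P x n) (k x))"
    by (intro recursive_intros assms(2) recursive_compose2[OF assms(1)])
  moreover have "rec_nat True (\<lambda>n r. r \<and> P x n) m \<longleftrightarrow> (\<forall>n<m. P x n)" for x m
    by (induction m) (auto simp: less_Suc_eq)
  ultimately show ?thesis by simp
qed

lemma recursive_fun_upd:
  assumes "recursive A f"
  shows "recursive A (f(a := b))"
  unfolding fun_upd_def by (intro recursive_intros assms)

text \<open>A finite table of exceptions can be built into a program, even if its values are not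
  given effectively. The induction removes one exception at a time.\<close>

lemma recursive_almost_const:
  assumes "finite {x. f x \<noteq> c}"
  shows "recursive A f"
proof -
  have "recursive A f" if "finite S" "{x. f x \<noteq> c} = S" for S and f
    using that
  proof (induction S arbitrary: f)
    case empty
    then have "f = (\<lambda>_. c)" by auto
    then show ?case by (simp add: recursive_const)
  next
    case (insert a S)
    then have "recursive A (f(a := c))" by (intro insert.IH) auto
    then show ?case using recursive_fun_upd[of A "f(a := c)" a "f a"] by simp
  qed
  then show ?thesis using assms by blast
qed

lemma recursive_prod_encode:
  assumes "recursive A f" "recursive A g"
  shows "recursive A (\<lambda>x. prod_encode (f x, g x))"
  using recursive_Pair[OF assms] unfolding recursive_def by (simp add: code_prod_def)

subsection \<open>Lists\<close>

lemma code_Nil: "code [] = 0"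
  by (simp add: code_list_def)

lemma code_Cons: "code (x # xs) = Suc (code (x, xs))"
  by (simp add: code_list_def code_prod_def)

text \<open>Provides a computable number of rounds that suffices to traverse a list, before
  \<open>length\<close> is known to be recursive.\<close>

lemma length_le_code: "length xs \<le> code xs"
proof (induction xs)
  case (Cons x xs)
  then show ?case
    using le_prod_encode_2[of "code xs" "code x"] by (simp add: code_Cons code_prod_def)
qed simp

lemma recursive_Cons [recursive_intros]:
  assumes "recursive A f" "recursive A g"
  shows "recursive A (\<lambda>x. f x # g x)"
  by (rule recursive_via_code[OF _ recursive_Pair[OF assms], of Suc])
    (intro recursive_intros, simp add: code_Cons)

lemma recursive_fst_decode: "recursive A (\<lambda>n. fst (prod_decode n))"
  by (rule recursiveI[where p = fst_prog])
    (metis code_nat_def eval_fst_prog prod.collapse prod_decode_inverse)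

lemma recursive_snd_decode: "recursive A (\<lambda>n. snd (prod_decode n))"
  by (rule recursiveI[where p = snd_prog])
    (metis code_nat_def eval_snd_prog prod.collapse prod_decode_inverse)

lemma recursive_tl [recursive_intros]:
  assumes "recursive A f"
  shows "recursive A (\<lambda>x. tl (f x))"
proof (rule recursive_via_code[OF _ assms])
  show "recursive A (\<lambda>n::nat. snd (prod_decode (n - 1)))"
    by (intro recursive_compose[OF recursive_snd_decode] recursive_intros)
  \<comment> \<open>For the empty list, whose code is \<open>0\<close>, the truncated
    \<open>0 - 1\<close> decodes to \<open>(0, 0)\<close>, and the second component is again the
    code of \<open>[]\<close>.\<close>
  have "prod_decode 0 = (0, 0)"
    using prod_encode_inverse[of "(0, 0)"] by (simp add: prod_encode_def)
  then show "code (tl (f x)) = snd (prod_decode (code (f x) - 1))" for x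
    by (cases "f x") (simp_all add: code_Nil code_Cons code_prod_def)
qed

lemma recursive_hd [recursive_intros]:
  fixes f :: "'a::code \<Rightarrow> 'b::code list"
  assumes "recursive A f"
  shows "recursive A (\<lambda>x. hd (f x))"
proof (rule recursive_via_code[OF _ assms])
  \<comment> \<open>The unspecified \<open>hd []\<close> is some fixed value, so its code can be a
    constant of the program.\<close>
  let ?F = "\<lambda>n::nat. if n = 0 then code (hd ([] :: 'b list)) else fst (prod_decode (n - 1))"
  show "recursive A ?F"
    by (intro recursive_compose[OF recursive_fst_decode] recursive_intros)
  show "code (hd (f x)) = ?F (code (f x))" for x
    by (cases "f x") (simp_all add: code_Nil code_Cons code_prod_def)
qed

lemma recursive_foldl [recursive_intros]:
  fixes h :: "'a::code \<Rightarrow> 'b::code \<Rightarrow> 'c::code \<Rightarrow> 'b"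
  assumes h: "recursive A (\<lambda>z. h (fst z) (fst (snd z)) (snd (snd z)))"
    and g: "recursive A g" and l: "recursive A l"
  shows "recursive A (\<lambda>x. foldl (h x) (g x) (l x))"
proof -
  \<comment> \<open>The state pairs the remaining list with the accumulator. A finished state is a
    fixed point, so surplus rounds are harmless.\<close>
  define step where
    "step x s = (if fst s = [] then s else (tl (fst s), h x (snd s) (hd (fst s))))" for x s
  have step: "step x ([], a) = ([], a)" "step x (y # ys, a) = (ys, h x a y)" for x y ys a
    by (simp_all add: step_def)
  have iter: "snd (rec_nat (xs, a) (\<lambda>_. step x) n) = foldl (h x) a xs" if "length xs \<le> n" for x xs a n
    using that
  proof (induction n arbitrary: xs a)
    case (Suc n)
    have "rec_nat s (\<lambda>_. step x) (Suc n) = rec_nat (step x s) (\<lambda>_. step x) n" for s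
      by (induction n) simp_all
    then have "snd (rec_nat (xs, a) (\<lambda>_. step x) (Suc n)) = snd (rec_nat (step x (xs, a)) (\<lambda>_. step x) n)"
      by (simp only:)
    also have "\<dots> = foldl (h x) a xs" using Suc by (cases xs) (simp_all add: step)
    finally show ?case .
  qed simp
  have h': "recursive A (\<lambda>z. h (fst z) (f z) (g z))" if "recursive A f" "recursive A g" for f g
    using recursive_compose[OF h recursive_Pair[OF recursive_fst[OF recursive_id] recursive_Pair[OF that]]]
    by simp
  have "recursive A (\<lambda>x. code (l x))" using l unfolding recursive_def by simp
  then have "recursive A (\<lambda>x. snd (rec_nat (l x, g x) (\<lambda>_. step x) (code (l x))))"
    unfolding step_def by (intro recursive_intros g l h')
  then show ?thesis by (simp add: iter length_le_code)
qed

lemma recursive_rev [recursive_intros]: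
  assumes "recursive A f"
  shows "recursive A (\<lambda>x. rev (f x))"
proof -
  have "recursive A (\<lambda>x. foldl (\<lambda>ys y. y # ys) [] (f x))" by (intro recursive_intros assms)
  then show ?thesis by (simp add: foldl_conv_fold rev_conv_fold)
qed

lemma recursive_append [recursive_intros]:
  assumes "recursive A f" "recursive A g"
  shows "recursive A (\<lambda>x. f x @ g x)"
proof -
  have "recursive A (\<lambda>x. foldl (\<lambda>ys y. y # ys) (g x) (rev (f x)))"
    by (intro recursive_intros assms)
  moreover have "foldl (\<lambda>ys y. y # ys) ys (rev xs) = xs @ ys" for xs ys :: "'b list"
    by (induction xs) auto
  ultimately show ?thesis by simp
qed

lemma recursive_length [recursive_intros]:
  assumes "recursive A f"
  shows "recursive A (\<lambda>x. length (f x))"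
proof -
  have "recursive A (\<lambda>x. foldl (\<lambda>n _. Suc n) 0 (f x))" by (intro recursive_intros assms)
  moreover have "foldl (\<lambda>n _. Suc n) m xs = m + length xs" for m and xs :: "'b list"
    by (induction xs arbitrary: m) auto
  ultimately show ?thesis by simp
qed

lemma recursive_drop [recursive_intros]:
  assumes "recursive A n" "recursive A f"
  shows "recursive A (\<lambda>x. drop (n x) (f x))"
proof -
  have "recursive A (\<lambda>x. rec_nat (f x) (\<lambda>_ xs. tl xs) (n x))" by (intro recursive_intros assms)
  moreover have "rec_nat xs (\<lambda>_ xs. tl xs) m = drop m xs" for m and xs :: "'b list"
    by (induction m) (simp_all add: drop_Suc tl_drop)
  ultimately show ?thesis by simp
qed

lemma recursive_take [recursive_intros]:
  assumes "recursive A n" "recursive A f"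
  shows "recursive A (\<lambda>x. take (n x) (f x))"
proof -
  have "recursive A (\<lambda>x. rev (drop (length (f x) - n x) (rev (f x))))"
    by (intro recursive_intros assms)
  moreover have "rev (drop (length xs - m) (rev xs)) = take m xs" for m and xs :: "'b list"
    by (cases "m \<le> length xs") (simp_all add: rev_drop)
  ultimately show ?thesis by simp
qed

text \<open>An out-of-range index must be guarded against, since \<^term>\<open>[] ! n\<close> is unspecified.\<close>

lemma recursive_nth:
  assumes "recursive A f" "recursive A n" "\<And>x. n x < length (f x)"
  shows "recursive A (\<lambda>x. f x ! n x)"
proof -
  have "recursive A (\<lambda>x. hd (drop (n x) (f x)))" by (intro recursive_intros assms)
  then show ?thesis by (simp add: hd_drop_conv_nth assms(3))
qed

subsection \<open>Computability and the limit lemma\<close>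

lemma computable_fun_iff: "computable_fun f \<longleftrightarrow> recursive {} f"
  unfolding computable_fun_def recursive_def by simp

lemma turing_reducible_iff: "A \<le>\<^sub>T B \<longleftrightarrow> recursive B (\<lambda>x. x \<in> A)"
  unfolding turing_reducible_def recursive_def by simp

lemma computable_rel2_iff: "computable_rel2 R \<longleftrightarrow> recursive {} (\<lambda>z. R (fst z) (snd z))"
proof
  assume "computable_rel2 R"
  then obtain p where p: "\<And>x y. eval {} p [x, y] (of_bool (R x y))"
    unfolding computable_rel2_def by blast
  show "recursive {} (\<lambda>z. R (fst z) (snd z))"
    unfolding recursive_def code_prod_def code_nat_def code_bool_def
    by (intro exI[of _ "Comp p [fst_prog, snd_prog]"] allI)
      (rule eval_basic eval_fst_prog eval_snd_prog p)+
next
  assume "recursive {} (\<lambda>z. R (fst z) (snd z))"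
  then obtain p where p: "\<forall>z. eval {} p [code z] (code (R (fst z) (snd z)))"
    by (rule recursiveE)
  have "eval {} (Comp p [pair_prog]) [x, y] (of_bool (R x y))" for x y
    using p[rule_format, of "(x, y)"] by (auto simp: code_prod_def intro!: eval_Comp1 eval_pair_prog)
  then show "computable_rel2 R" unfolding computable_rel2_def by blast
qed

lemma computable_rel3_iff:
  "computable_rel3 R \<longleftrightarrow> recursive {} (\<lambda>z. R (fst z) (fst (snd z)) (snd (snd z)))"
proof
  assume "computable_rel3 R"
  then obtain p where p: "\<And>x y z. eval {} p [x, y, z] (of_bool (R x y z))"
    unfolding computable_rel3_def by blast
  show "recursive {} (\<lambda>z. R (fst z) (fst (snd z)) (snd (snd z)))"
    unfolding recursive_def code_prod_def code_nat_def code_bool_def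
    by (intro exI[of _ "Comp p [fst_prog, Comp fst_prog [snd_prog], Comp snd_prog [snd_prog]]"] allI)
      (rule eval_basic eval_fst_prog eval_snd_prog p)+
next
  assume "recursive {} (\<lambda>z. R (fst z) (fst (snd z)) (snd (snd z)))"
  then obtain p where p: "\<forall>z. eval {} p [code z] (code (R (fst z) (fst (snd z)) (snd (snd z))))"
    by (rule recursiveE)
  have "eval {} (Comp p [Comp pair_prog [Proj 0, Comp pair_prog [Proj (Suc 0), Proj 2]]]) [x, y, z]
      (of_bool (R x y z))" for x y z
    using p[rule_format, of "(x, y, z)"] by (auto simp: code_prod_def intro!: eval_basic eval_pair_prog)
  then show "computable_rel3 R" unfolding computable_rel3_def by blast
qed

text \<open>Since the approximation settles, "true from some stage on" and "true at arbitrarily late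
  stages" both define \<open>D\<close>; the first is a \<open>Sigma2\<close> form and the second a
  \<open>Pi2\<close> form.\<close>

lemma Delta2_of_limit:
  assumes h: "recursive {} (\<lambda>z. h (fst z) (snd z))"
    and lim: "\<And>x. \<forall>\<^sub>F t in sequentially. h x t \<longleftrightarrow> x \<in> D"
  shows "Delta2 D"
proof -
  have h': "recursive {} (\<lambda>z. h (f z) (g z))" if "recursive {} f" "recursive {} g" for f g
    by (rule recursive_compose2[OF h that])
  have lim': "\<exists>T. \<forall>t\<ge>T. h x t \<longleftrightarrow> x \<in> D" for x
    using lim[of x] by (simp add: eventually_sequentially)
  have "computable_rel3 (\<lambda>x y z. y \<le> z \<longrightarrow> h x z)" "computable_rel3 (\<lambda>x y z. y \<le> z \<and> h x z)"
    unfolding computable_rel3_iff by (intro recursive_intros h')+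
  moreover have "D = {x. \<exists>y. \<forall>z. y \<le> z \<longrightarrow> h x z}" "D = {x. \<forall>y. \<exists>z. y \<le> z \<and> h x z}"
    using lim' by (auto, (metis nle_le)+)
  ultimately show ?thesis unfolding Delta2_def Sigma2_def Pi2_def by blast
qed

text \<open>Given \<open>x \<in> D \<longleftrightarrow> (\<exists>y. \<forall>z. R x y z)\<close> and \<open>x \<notin> D \<longleftrightarrow> (\<exists>y. \<forall>z. \<not> S x y z)\<close>, the two searches for a
  witness \<open>y\<close> race against each other: the correct one stabilises, the other one tends to infinity.\<close>

lemma limit_of_Delta2:
  assumes "Delta2 D"
  obtains h where "recursive {} (\<lambda>z. h (fst z) (snd z))"
    and "\<And>x. \<forall>\<^sub>F t in sequentially. h x t \<longleftrightarrow> x \<in> D"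
proof -
  obtain R S where R: "computable_rel3 R" "D = {x. \<exists>y. \<forall>z. R x y z}"
    and S: "computable_rel3 S" "D = {x. \<forall>y. \<exists>z. S x y z}"
    using assms unfolding Delta2_def Sigma2_def Pi2_def by blast
  \<comment> \<open>The least candidate witness not yet refuted by stage \<open>t\<close>; the
    disjunct \<open>t \<le> y\<close> caps the search, so it always ends.\<close>
  define w :: "(nat \<Rightarrow> nat \<Rightarrow> nat \<Rightarrow> bool) \<Rightarrow> nat \<Rightarrow> nat \<Rightarrow> nat"
    where "w Q x t = (LEAST y. t \<le> y \<or> (\<forall>z<t. Q x y z))" for Q x t
  have rec: "recursive {} (\<lambda>z. w Q (fst z) (snd z))"
    if "recursive {} (\<lambda>z. Q (fst z) (fst (snd z)) (snd (snd z)))" for Q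
  proof -
    have Q: "recursive {} (\<lambda>u. Q (f u) (g u) (h u))"
      if "recursive {} f" "recursive {} g" "recursive {} h" for f g h :: "_ \<Rightarrow> nat"
      using recursive_compose[OF \<open>recursive {} (\<lambda>z. Q _ _ _)\<close>
          recursive_Pair[OF that(1) recursive_Pair[OF that(2,3)]]] by simp
    show ?thesis unfolding w_def by (intro recursive_intros Q) auto
  qed
  have bounded: "\<exists>b. \<forall>t. w Q x t \<le> b" if "\<forall>z. Q x y z" for Q x y
    using that unfolding w_def by (intro exI[of _ y] allI Least_le) simp
  have unbounded: "\<forall>\<^sub>F t in sequentially. b < w Q x t" if unbounded: "\<forall>y. \<exists>z. \<not> Q x y z" for Q x b
  proof -
    obtain r where r: "\<And>y. \<not> Q x y (r y)" using unbounded by metis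
    \<comment> \<open>Past this bound the counterexamples \<open>r y\<close> to all candidates
      \<open>y \<le> b\<close> have been seen.\<close>
    have "b < w Q x t" if "t > b + (\<Sum>y\<le>b. r y)" for t
    proof -
      have "t \<le> w Q x t \<or> (\<forall>z<t. Q x (w Q x t) z)"
        unfolding w_def by (rule LeastI[of _ t]) simp
      moreover have "r y < t" if "y \<le> b" for y
        using \<open>t > _\<close> member_le_sum[of y "{..b}" r] that by simp
      ultimately show ?thesis using r \<open>t > _\<close> by (meson add_lessD1 le_less_linear less_le_trans)
    qed
    then show ?thesis unfolding eventually_at_top_dense by blast
  qed
  show ?thesis
  proof (rule that[of "\<lambda>x t. w R x t < w (\<lambda>x y z. \<not> S x y z) x t"])
    show "recursive {} (\<lambda>z. w R (fst z) (snd z) < w (\<lambda>x y z. \<not> S x y z) (fst z) (snd z))"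
      using R(1) S(1) unfolding computable_rel3_iff by (intro recursive_less rec recursive_not)
    show "\<forall>\<^sub>F t in sequentially. w R x t < w (\<lambda>x y z. \<not> S x y z) x t \<longleftrightarrow> x \<in> D" for x
    proof (cases "x \<in> D")
      case True
      then obtain b where "\<And>t. w R x t \<le> b" using R(2) bounded by blast
      moreover have "\<forall>\<^sub>F t in sequentially. b < w (\<lambda>x y z. \<not> S x y z) x t"
        using True S(2) by (intro unbounded) auto
      ultimately show ?thesis using True by (auto elim!: eventually_mono intro: le_less_trans)
    next
      case False
      then obtain b where "\<And>t. w (\<lambda>x y z. \<not> S x y z) x t \<le> b" using S(2) bounded[of "\<lambda>x y z. \<not> S x y z"] by blast
      moreover have "\<forall>\<^sub>F t in sequentially. b < w R x t"
        using False R(2) by (intro unbounded) auto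
      ultimately show ?thesis using False
        by (auto elim!: eventually_mono simp: not_less) (meson le_less_trans order_less_imp_le)
    qed
  qed
qed

subsection \<open>Coding a set into a copy\<close>

text \<open>An entry \<open>(x, j, u, v)\<close> is an element \<open>x\<close> of the copy that wants the colour \<open>u\<close> or \<open>v\<close>,
  depending on whether \<open>j\<close> currently belongs to the set to be coded.\<close>

type_synonym entry = "nat \<times> nat \<times> nat \<times> nat"

definition colour :: "(nat \<Rightarrow> bool) \<Rightarrow> entry \<Rightarrow> nat" where
  "colour P e = (if P (fst (snd e)) then fst (snd (snd e)) else snd (snd (snd e)))"

text \<open>\<open>N\<close> bounds the positions of the colours which \<open>f\<close> takes only finitely often; the first \<open>N\<close>
  entries never move. The set \<open>D\<close> is the limit of \<open>h\<close>.\<close>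

locale coding_copy =
  fixes f :: "nat \<Rightarrow> nat" and h :: "nat \<Rightarrow> nat \<Rightarrow> bool" and D :: "nat set" and c d N :: nat
  assumes recurring: "N \<le> n \<Longrightarrow> \<exists>k\<ge>m. f k = f n"
    and c_recurs: "\<exists>k\<ge>m. f k = c" and d_recurs: "\<exists>k\<ge>m. f k = d" and c_neq_d: "c \<noteq> d"
    and limit: "\<forall>\<^sub>F t in sequentially. h j t \<longleftrightarrow> j \<in> D"
begin

abbreviation stage_colour :: "nat \<Rightarrow> entry \<Rightarrow> nat" where
  "stage_colour t \<equiv> colour (\<lambda>j. h j t)"

abbreviation final_colour :: "entry \<Rightarrow> nat" where
  "final_colour \<equiv> colour (\<lambda>j. j \<in> D)"

text \<open>The default \<open>length xs\<close> is also the place where a coding element is put on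
  top, so \<open>step\<close> can treat both cases as an insertion at the gap.\<close>

definition gap :: "nat \<Rightarrow> entry list \<Rightarrow> nat" where
  "gap t xs = (LEAST i. length xs \<le> i \<or> f i \<noteq> stage_colour t (xs ! i))"

text \<open>A state consists of the next number to be coded and the current finite order. An entry of the
  wrong colour is pushed upwards by inserting below it a new element that keeps the colour of its
  initial position for ever; if all colours are right then a new coding element is put on top.\<close>

definition step :: "nat \<Rightarrow> nat \<times> entry list \<Rightarrow> nat \<times> entry list" where
  "step t s =
    (if gap t (snd s) < length (snd s) then fst s else Suc (fst s),
     take (gap t (snd s)) (snd s) @
     (length (snd s),
      if gap t (snd s) < length (snd s) then (0, f (gap t (snd s)), f (gap t (snd s)))
      else (fst s, c, d)) #
     drop (gap t (snd s)) (snd s))"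

primrec state :: "nat \<Rightarrow> nat \<times> entry list" where
  "state 0 = (0, map (\<lambda>i. (i, 0, f i, f i)) [0..<N])"
| "state (Suc t) = step t (state t)"

definition line :: "nat \<Rightarrow> entry list" where
  "line t = snd (state t)"

definition count :: "nat \<Rightarrow> nat" where
  "count t = fst (state t)"

definition ins :: "nat \<Rightarrow> nat" where
  "ins t = gap t (line t)"

text \<open>\<open>N + t\<close> is the least number not yet in the line. Two equal colours make the
  colour constant; such entries get the default index \<open>0\<close>.\<close>

definition new :: "nat \<Rightarrow> entry" where
  "new t = (N + t, if ins t < N + t then (0, f (ins t), f (ins t)) else (count t, c, d))"

section \<open>Invariants of the finite orders\<close>

lemma gap_le: "gap t xs \<le> length xs"
  unfolding gap_def by (rule Least_le) simp

lemma length_line [simp]: "length (line t) = N + t"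
proof (induction t)
  case (Suc t)
  then show ?case using gap_le[of t "line t"] by (simp add: line_def step_def)
qed (simp add: line_def)

lemma line_Suc: "line (Suc t) = take (ins t) (line t) @ new t # drop (ins t) (line t)"
  using length_line[of t] by (simp add: line_def step_def ins_def new_def count_def)

lemma count_Suc: "count (Suc t) = (if ins t < N + t then count t else Suc (count t))"
  using length_line[of t] by (simp add: line_def step_def ins_def count_def)

lemma ins_le: "ins t \<le> N + t"
  using gap_le[of t "line t"] by (simp add: ins_def)

lemma below_ins:
  assumes "i < ins t"
  shows "f i = stage_colour t (line t ! i)"
  using not_less_Least[OF assms[unfolded ins_def gap_def]] by simp

lemma at_ins:
  assumes "ins t < N + t"
  shows "f (ins t) \<noteq> stage_colour t (line t ! ins t)"
  using LeastI[of "\<lambda>i. length (line t) \<le> i \<or> f i \<noteq> stage_colour t (line t ! i)" "N + t"] assms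
  unfolding gap_def[symmetric] ins_def[symmetric] by simp

lemma line_Suc_less: "i < ins t \<Longrightarrow> line (Suc t) ! i = line t ! i"
  using ins_le[of t] by (simp add: line_Suc nth_append)

lemma line_Suc_ins: "line (Suc t) ! ins t = new t"
  using ins_le[of t] by (simp add: line_Suc nth_append)

lemma line_Suc_Suc: "ins t \<le> i \<Longrightarrow> i < N + t \<Longrightarrow> line (Suc t) ! Suc i = line t ! i"
  using ins_le[of t] by (simp add: line_Suc nth_append Suc_diff_le)

lemma elements_line: "set (map fst (line t)) = {..<N + t}"
proof (induction t)
  case 0
  have "fst \<circ> (\<lambda>i. (i, 0, f i, f i)) = id" by auto
  then show ?case by (auto simp: line_def)
next
  case (Suc t)
  have "set (map fst (line (Suc t))) = insert (N + t) (fst ` (set (take (ins t) (line t)) \<union> set (drop (ins t) (line t))))"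
    by (auto simp: line_Suc new_def)
  also have "set (take (ins t) (line t)) \<union> set (drop (ins t) (line t)) = set (line t)"
    by (metis append_take_drop_id set_append)
  finally show ?case using Suc by auto
qed

lemma distinct_line: "distinct (map fst (line t))"
  by (rule card_distinct) (simp only: elements_line card_lessThan length_map length_line)

subsection \<open>Positions\<close>

text \<open>The search is bounded by the length of the line, so it ends even for an absent
  \<open>x\<close> and \<open>pos\<close> is recursive.\<close>

definition pos :: "nat \<Rightarrow> nat \<Rightarrow> nat" where
  "pos t x = (LEAST i. N + t \<le> i \<or> fst (line t ! i) = x)"

lemma pos_less: "x < N + t \<Longrightarrow> pos t x < N + t"
  and fst_line_pos: "x < N + t \<Longrightarrow> fst (line t ! pos t x) = x"
proof -
  assume "x < N + t"
  then obtain i where i: "i < N + t" "fst (line t ! i) = x"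
    using elements_line[of t] by (metis in_set_conv_nth length_map length_line lessThan_iff nth_map)
  then show less: "pos t x < N + t"
    using Least_le[of "\<lambda>i. N + t \<le> i \<or> fst (line t ! i) = x" i] unfolding pos_def by simp
  show "fst (line t ! pos t x) = x"
    using LeastI[of "\<lambda>i. N + t \<le> i \<or> fst (line t ! i) = x" i] i less
    unfolding pos_def[symmetric] by simp
qed

lemma fst_line_less: "i < N + t \<Longrightarrow> fst (line t ! i) < N + t"
  using elements_line[of t] by (metis length_map length_line lessThan_iff nth_map nth_mem)

lemma pos_fst_line:
  assumes "i < N + t"
  shows "pos t (fst (line t ! i)) = i"
proof -
  let ?x = "fst (line t ! i)"
  have x: "?x < N + t" using assms by (rule fst_line_less)
  then show ?thesis
    using distinct_line[of t] assms pos_less[OF x] fst_line_pos[OF x]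
    by (metis length_map length_line nth_eq_iff_index_eq nth_map)
qed

lemma pos_Suc:
  assumes "x < N + t"
  shows "pos (Suc t) x = (if pos t x < ins t then pos t x else Suc (pos t x))"
proof -
  let ?i = "if pos t x < ins t then pos t x else Suc (pos t x)"
  have "fst (line (Suc t) ! ?i) = x" "?i < N + Suc t"
    using assms pos_less[OF assms] fst_line_pos[OF assms]
    by (auto simp: line_Suc_less line_Suc_Suc)
  then show ?thesis using pos_fst_line[of ?i "Suc t"] by simp
qed

lemma pos_new: "pos (Suc t) (N + t) = ins t"
  using pos_fst_line[of "ins t" "Suc t"] ins_le[of t] by (simp add: line_Suc_ins new_def)

text \<open>An insertion never exchanges two elements, so their order is final once both are
  present. This makes the copy computable although positions change.\<close>

lemma pos_less_iff:
  assumes "x < N + s" "y < N + s" "s \<le> t"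
  shows "pos t x < pos t y \<longleftrightarrow> pos s x < pos s y"
  using assms(3)
proof (induction t rule: dec_induct)
  case (step t)
  then show ?case using assms(1,2) by (auto simp: pos_Suc)
qed simp

definition entry_of :: "nat \<Rightarrow> entry" where
  "entry_of x = line (Suc x) ! pos (Suc x) x"

text \<open>Insertions move entries without altering them. Stage \<open>Suc x\<close> may come
  before or after \<open>t\<close>, hence the comparison in both directions.\<close>

lemma line_pos:
  assumes "x < N + t"
  shows "line t ! pos t x = entry_of x"
proof -
  have mono: "line t ! pos t x = line s ! pos s x" if "s \<le> t" "x < N + s" for s t
    using that(1)
  proof (induction t rule: dec_induct)
    case (step t)
    then show ?case using that(2) pos_less[of x t]
      by (auto simp: pos_Suc line_Suc_less line_Suc_Suc)
  qed simp
  show ?thesis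
    using mono[of "Suc x" t] mono[of t "Suc x"] assms unfolding entry_of_def
    by (cases "Suc x \<le> t") auto
qed

lemma entry_of_new: "entry_of (N + t) = new t"
  using line_pos[of "N + t" "Suc t"] by (simp add: pos_new line_Suc_ins)

text \<open>The initial entries constantly have the colour of their own position, so no gap occurs
  among them, and without a gap there they do not move.\<close>

lemma line_initial: "i < N \<Longrightarrow> line t ! i = (i, 0, f i, f i)"
  and N_le_ins: "N \<le> ins t"
proof -
  have *: "N \<le> ins t" if "\<forall>i<N. line t ! i = (i, 0, f i, f i)" for t
    using at_ins[of t] that by (metis colour_def fst_conv leI snd_conv trans_less_add1)
  have **: "\<forall>i<N. line t ! i = (i, 0, f i, f i)"
  proof (induction t)
    case (Suc t)
    show ?case using Suc *[OF Suc] by (simp add: line_Suc_less)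
  qed (simp add: line_def)
  show "i < N \<Longrightarrow> line t ! i = (i, 0, f i, f i)" using ** by blast
  show "N \<le> ins t" using * ** by blast
qed

text \<open>The colours of a later element are \<open>c\<close> and \<open>d\<close>, or that of its
  place of insertion, which is at least \<open>N\<close>.\<close>

lemma colour_recurs:
  assumes "N \<le> x"
  shows "\<exists>k\<ge>m. f k = colour P (entry_of x)"
proof -
  obtain t where "x = N + t" using assms le_Suc_ex by blast
  then show ?thesis
    using recurring[OF N_le_ins[of t]] c_recurs d_recurs
    by (auto simp: entry_of_new new_def colour_def)
qed

subsection \<open>Every element finds its final position\<close>

text \<open>The entries strictly below position \<open>i\<close> are frozen from stage
  \<open>t\<close> on; an insertion at \<open>i\<close> itself is still allowed.\<close>

definition stable :: "nat \<Rightarrow> nat \<Rightarrow> bool" where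
  "stable t i \<longleftrightarrow> (\<forall>s\<ge>t. i \<le> ins s)"

text \<open>An insertion at \<open>i\<close> requires a wrong colour there, but the entry at
  \<open>i\<close> always has the right one and so remains in place.\<close>

lemma stable_Suc:
  assumes "stable t i" "i < N + t" "\<And>s. t \<le> s \<Longrightarrow> stage_colour s (line t ! i) = f i"
  shows "stable t (Suc i)"
proof -
  have nth: "line s ! i = line t ! i" if "t \<le> s" for s
    using that
  proof (induction s rule: dec_induct)
    case (step s)
    have "i \<noteq> ins s"
      using at_ins[of s] assms(2) assms(3)[of s] step by auto
    then have "i < ins s" using assms(1) step unfolding stable_def by (simp add: le_neq_implies_less)
    then show ?case using step by (simp add: line_Suc_less)
  qed simp
  have "i \<noteq> ins s" if "t \<le> s" for s
    using at_ins[of s] assms(2) assms(3)[of s] nth[of s] that by auto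
  then show ?thesis using assms(1) unfolding stable_def by (simp add: Suc_leI le_neq_implies_less)
qed

text \<open>The entry at \<open>i\<close> is pushed up one position per stage until it meets its
  colour \<open>a\<close>, at \<open>q\<close> at the latest. Everything above moves along rigidly;
  the clause on \<open>r\<close> records this so that the next entry can be treated in turn.\<close>

lemma settle:
  assumes "i \<le> q" "f q = a" "stable t i" "i < N + t"
    "\<And>s. t \<le> s \<Longrightarrow> stage_colour s (line t ! i) = a"
  shows "\<exists>t' i'. t \<le> t' \<and> i \<le> i' \<and> stable t' (Suc i') \<and>
    (\<forall>r. i + r < N + t \<longrightarrow> i' + r < N + t' \<and> line t' ! (i' + r) = line t ! (i + r))"
  using assms
proof (induction "q - i" arbitrary: i t)
  case 0
  then have "stable t (Suc i)" by (intro stable_Suc) auto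
  then show ?case by blast
next
  case (Suc n)
  show ?case
  proof (cases "f i = a")
    case True
    then have "stable t (Suc i)" using Suc.prems by (intro stable_Suc) auto
    then show ?thesis by blast
  next
    case False
    \<comment> \<open>\<open>stable\<close> excludes a gap below \<open>i\<close>, and the wrong
      colour at \<open>i\<close> excludes one above it.\<close>
    then have "i = ins t"
      using Suc.prems below_ins[of i t] unfolding stable_def by force
    then have shift: "line (Suc t) ! (Suc i + r) = line t ! (i + r)" if "i + r < N + t" for r
      using line_Suc_Suc[of t "i + r"] that by simp
    have new: "line (Suc t) ! i = (N + t, 0, f i, f i)"
      using \<open>i = ins t\<close> Suc.prems(4) line_Suc_ins[of t] by (simp add: new_def)
    have n: "n = q - Suc i" using Suc.hyps(2) by simp
    have "stable (Suc t) (Suc i)"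
      using Suc.prems(3,4) by (intro stable_Suc) (auto simp: stable_def new colour_def)
    moreover have "Suc i \<le> q" using False Suc.prems(1,2) by (metis le_neq_implies_less Suc_leI)
    moreover have "stage_colour s (line (Suc t) ! Suc i) = a" if "Suc t \<le> s" for s
      using shift[of 0] Suc.prems(4) Suc.prems(5)[of s] that by simp
    ultimately obtain t' i' where *: "Suc t \<le> t'" "Suc i \<le> i'" "stable t' (Suc i')"
      "\<forall>r. Suc i + r < N + Suc t \<longrightarrow> i' + r < N + t' \<and> line t' ! (i' + r) = line (Suc t) ! (Suc i + r)"
      using Suc.hyps(1)[of "Suc i" "Suc t"] n Suc.prems(2,4) by auto
    then show ?thesis using shift by (intro exI[of _ t'] exI[of _ i']) auto
  qed
qed

lemma settle_next:
  assumes "N \<le> i" "stable t i" "i < N + t"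
    "\<And>s. t \<le> s \<Longrightarrow> stage_colour s (line t ! i) = final_colour (line t ! i)"
  obtains t' i' where "t \<le> t'" "i \<le> i'" "stable t' (Suc i')"
    "\<And>r. i + r < N + t \<Longrightarrow> i' + r < N + t' \<and> line t' ! (i' + r) = line t ! (i + r)"
proof -
  \<comment> \<open>An element below \<open>N\<close> sits at the position equal to itself, which
    would be below \<open>N\<close>.\<close>
  have "N \<le> fst (line t ! i)"
    using assms(1) line_initial[of "fst (line t ! i)" t] pos_fst_line[OF assms(3)]
      pos_fst_line[of "fst (line t ! i)" t] assms(3) by (metis fst_conv leI trans_less_add1)
  then obtain q where "i \<le> q" "f q = final_colour (line t ! i)"
    using colour_recurs[of "fst (line t ! i)" i "\<lambda>j. j \<in> D"] line_pos[OF fst_line_less[OF assms(3)]]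
    by (auto simp: pos_fst_line[OF assms(3)])
  then show thesis
    using settle[of i q "final_colour (line t ! i)" t] assms(2-4) that by blast
qed

text \<open>The block is settled entry by entry from below: once the lowest entry rests at
  \<open>i'\<close>, the remaining block starts unchanged at \<open>Suc i'\<close>.\<close>

lemma settle_all:
  assumes "N \<le> i" "stable t i" "i + r < N + t"
    "\<And>k s. k \<le> r \<Longrightarrow> t \<le> s \<Longrightarrow> stage_colour s (line t ! (i + k)) = final_colour (line t ! (i + k))"
  shows "\<exists>t' i'. i' < N + t' \<and> stable t' (Suc i') \<and> line t' ! i' = line t ! (i + r)"
  using assms
proof (induction r arbitrary: i t)
  case (0 i t)
  obtain t' i' where *: "stable t' (Suc i')"
    "\<And>r. i + r < N + t \<Longrightarrow> i' + r < N + t' \<and> line t' ! (i' + r) = line t ! (i + r)"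
  proof (rule settle_next[OF 0(1,2)])
    show "stage_colour s (line t ! i) = final_colour (line t ! i)" if "t \<le> s" for s
      using 0(4)[of 0 s] that by simp
  qed (use 0(3) in simp, blast)
  then show ?case using *(2)[of 0] 0(3) by (intro exI[of _ t'] exI[of _ i']) simp
next
  case (Suc r i t)
  have i: "i < N + t" using Suc.prems(3) by simp
  obtain t' i' where *: "t \<le> t'" "i \<le> i'" "stable t' (Suc i')"
    "\<And>r. i + r < N + t \<Longrightarrow> i' + r < N + t' \<and> line t' ! (i' + r) = line t ! (i + r)"
  proof (rule settle_next[OF Suc.prems(1,2) i])
    show "stage_colour s (line t ! i) = final_colour (line t ! i)" if "t \<le> s" for s
      using Suc.prems(4)[of 0 s] that by simp
  qed blast
  have nth: "line t' ! (Suc i' + k) = line t ! (i + Suc k)" if "k \<le> r" for k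
    using *(4)[of "Suc k"] Suc.prems(3) that by simp
  have "\<exists>t'' i''. i'' < N + t'' \<and> stable t'' (Suc i'') \<and> line t'' ! i'' = line t' ! (Suc i' + r)"
  proof (rule Suc.IH)
    show "N \<le> Suc i'" using Suc.prems(1) *(2) by simp
    show "stable t' (Suc i')" by fact
    show "Suc i' + r < N + t'" using *(4)[OF Suc.prems(3)] by simp
    show "stage_colour s (line t' ! (Suc i' + k)) = final_colour (line t' ! (Suc i' + k))"
      if "k \<le> r" "t' \<le> s" for k s
      using nth[OF that(1)] Suc.prems(4)[of "Suc k" s] that *(1) by simp
  qed
  then show ?case using nth[of r] by simp
qed

text \<open>New coding elements are put on top, so below a given element only constantly coloured
  ones are added.\<close>

lemma entries_below:
  assumes "x < N + s" "s \<le> t" "i \<le> pos t x"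
  shows "line t ! i \<in> set (line s) \<or> (\<exists>y v. line t ! i = (y, 0, v, v))"
  using assms(2,3)
proof (induction t arbitrary: i rule: dec_induct)
  case base
  then show ?case using pos_less[OF assms(1)] by (metis le_less_trans length_line nth_mem)
next
  case (step t)
  have less: "pos t x < N + t" using assms(1) step.hyps by (intro pos_less) simp
  have pos: "pos (Suc t) x = (if pos t x < ins t then pos t x else Suc (pos t x))"
    using assms(1) step.hyps by (intro pos_Suc) simp
  consider "i < ins t" | "i = ins t" | k where "i = Suc k" "ins t \<le> k"
    by (metis Suc_le_D Suc_le_eq linorder_neqE_nat not_less_eq_eq)
  then show ?case
  proof cases
    case 1
    then show ?thesis using step pos by (simp add: line_Suc_less split: if_splits)
  next
    case 2
    then have "ins t < N + t" using step.prems pos less by (auto split: if_splits)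
    then show ?thesis using 2 by (simp add: line_Suc_ins new_def)
  next
    case 3
    then have "k \<le> pos t x" using step.prems pos by (auto split: if_splits)
    then show ?thesis using 3 step.IH[of k] less by (simp add: line_Suc_Suc)
  qed
qed

lemma settled_colours:
  "\<exists>T. \<forall>t\<ge>T. \<forall>e\<in>set xs. stage_colour t e = final_colour e"
proof -
  have "\<forall>\<^sub>F t in sequentially. stage_colour t e = final_colour e" for e
    using limit[of "fst (snd e)"] by (rule eventually_mono) (simp add: colour_def)
  then have "\<forall>\<^sub>F t in sequentially. \<forall>e\<in>set xs. stage_colour t e = final_colour e"
    by (intro eventually_ball_finite) auto
  then show ?thesis by (simp add: eventually_sequentially)
qed

text \<open>Wait until the approximation is final on the finitely many entries of
  \<open>line (Suc x)\<close>. By \<open>entries_below\<close> every other entry below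
  \<open>x\<close> has constant colour, so \<open>settle_all\<close> applies to the block from
  \<open>N\<close> up to \<open>x\<close>.\<close>

lemma eventually_stable: "\<exists>t. x < N + t \<and> stable t (Suc (pos t x))"
proof (cases "x < N")
  case True
  then have "pos 0 x = x"
    using pos_fst_line[of x 0] by (simp add: line_initial)
  then show ?thesis using True N_le_ins by (intro exI[of _ 0]) (auto simp: stable_def intro: Suc_leI less_le_trans)
next
  case False
  obtain T where T: "\<And>t e. T \<le> t \<Longrightarrow> e \<in> set (line (Suc x)) \<Longrightarrow> stage_colour t e = final_colour e"
    using settled_colours[of "line (Suc x)"] by blast
  define t where "t = max T (Suc x)"
  have x: "x < N + t" by (simp add: t_def)
  have "N \<le> pos t x"
    using False line_initial[of "pos t x" t] fst_line_pos[OF x] by (metis fst_conv leI)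
  then obtain r where r: "pos t x = N + r" using le_Suc_ex by blast
  have "\<exists>t' i'. i' < N + t' \<and> stable t' (Suc i') \<and> line t' ! i' = line t ! (N + r)"
  proof (rule settle_all)
    show "stable t N" using N_le_ins by (simp add: stable_def)
    show "N + r < N + t" using pos_less[OF x] r by simp
    fix k s assume "k \<le> r" "t \<le> s"
    then consider "line t ! (N + k) \<in> set (line (Suc x))"
      | y v where "line t ! (N + k) = (y, 0, v, v)"
      using entries_below[of x "Suc x" t "N + k"] r by (auto simp: t_def)
    then show "stage_colour s (line t ! (N + k)) = final_colour (line t ! (N + k))"
      using T[of s] \<open>t \<le> s\<close> by cases (simp_all add: t_def colour_def)
  qed simp
  then obtain t' i' where *: "i' < N + t'" "stable t' (Suc i')" "line t' ! i' = line t ! pos t x"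
    using r by auto
  then have "pos t' x = i'" using pos_fst_line[OF *(1)] fst_line_pos[OF x] by simp
  moreover have "x < N + t'" using fst_line_less[OF *(1)] *(3) fst_line_pos[OF x] by simp
  ultimately show ?thesis using * by blast
qed

lemma stable_pos:
  assumes "x < N + t" "stable t (Suc (pos t x))" "t \<le> s"
  shows "pos s x = pos t x"
  using assms(3)
proof (induction s rule: dec_induct)
  case (step s)
  then have "pos s x < ins s" using assms(2) by (simp add: stable_def Suc_le_eq)
  then show ?case using step assms(1) by (simp add: pos_Suc)
qed simp

section \<open>Limit positions and the order type of the copy\<close>

definition lim_pos :: "nat \<Rightarrow> nat" where
  "lim_pos x = (LEAST i. \<exists>T. \<forall>t\<ge>T. pos t x = i)"

text \<open>The last conjunct places \<open>x\<close> below the gap, where all colours are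
  right.\<close>

lemma lim_pos:
  "\<exists>T. \<forall>t\<ge>T. x < N + t \<and> pos t x = lim_pos x \<and> lim_pos x < ins t"
proof -
  obtain T where T: "x < N + T" "stable T (Suc (pos T x))" using eventually_stable by blast
  then have const: "\<forall>t\<ge>T. pos t x = pos T x" using stable_pos by blast
  have eq: "lim_pos x = pos T x"
    unfolding lim_pos_def
  proof (rule Least_equality)
    show "\<exists>T'. \<forall>t\<ge>T'. pos t x = pos T x" using const by blast
  next
    fix i assume "\<exists>T'. \<forall>t\<ge>T'. pos t x = i"
    then obtain T' where "\<forall>t\<ge>T'. pos t x = i" by blast
    then have "pos (max T T') x = i" by simp
    then show "pos T x \<le> i" using const[rule_format, of "max T T'"] by simp
  qed
  have "x < N + t \<and> pos t x = lim_pos x \<and> lim_pos x < ins t" if "T \<le> t" for t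
    using T const[rule_format, OF that] that by (auto simp: eq stable_def Suc_le_eq)
  then show ?thesis by blast
qed

lemma lim_pos2:
  obtains t where "x < N + t" "pos t x = lim_pos x" "lim_pos x < ins t"
    "y < N + t" "pos t y = lim_pos y" "lim_pos y < ins t" "T \<le> t"
proof -
  obtain T1 where "\<forall>t\<ge>T1. x < N + t \<and> pos t x = lim_pos x \<and> lim_pos x < ins t" using lim_pos by blast
  moreover obtain T2 where "\<forall>t\<ge>T2. y < N + t \<and> pos t y = lim_pos y \<and> lim_pos y < ins t" using lim_pos by blast
  ultimately show ?thesis using that[of "max T (max T1 T2)"] by simp
qed

lemma f_lim_pos: "f (lim_pos x) = final_colour (entry_of x)"
proof -
  obtain T where "\<And>t. T \<le> t \<Longrightarrow> stage_colour t (entry_of x) = final_colour (entry_of x)"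
    using settled_colours[of "[entry_of x]"] by auto
  then show ?thesis
    using lim_pos2[of x x T] below_ins line_pos by metis
qed

text \<open>At stage \<open>Suc (x + y)\<close> both elements are present, so their order is already
  final.\<close>

definition prec :: "nat \<Rightarrow> nat \<Rightarrow> bool" where
  "prec x y \<longleftrightarrow> pos (Suc (x + y)) x < pos (Suc (x + y)) y"

lemma prec_iff: "prec x y \<longleftrightarrow> lim_pos x < lim_pos y"
proof -
  obtain t where "pos t x = lim_pos x" "pos t y = lim_pos y" "Suc (x + y) \<le> t"
    using lim_pos2[of x y "Suc (x + y)"] by metis
  then show ?thesis
    using pos_less_iff[of x "Suc (x + y)" y t] unfolding prec_def by simp
qed

lemma inj_lim_pos: "inj lim_pos"
proof (rule injI)
  fix x y assume eq: "lim_pos x = lim_pos y"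
  obtain t where "x < N + t" "pos t x = lim_pos x" "y < N + t" "pos t y = lim_pos y"
    using lim_pos2[of x y] by metis
  then show "x = y" using eq fst_line_pos by metis
qed

text \<open>Once \<open>x\<close> has settled, insertions happen only above it, so the element found
  at position \<open>i\<close> stays there.\<close>

lemma lim_pos_downward: 
  assumes "i < lim_pos x"
  shows "i \<in> range lim_pos"
proof -
  obtain T where T: "\<And>t. T \<le> t \<Longrightarrow> x < N + t \<and> pos t x = lim_pos x \<and> lim_pos x < ins t"
    using lim_pos by blast
  have i: "i < N + T" using T[of T] pos_less[of x T] assms by simp
  define y where "y = fst (line T ! i)"
  have "pos t y = i" if "T \<le> t" for t
    using that
  proof (induction t rule: dec_induct)
    case base
    then show ?case using pos_fst_line[OF i] by (simp add: y_def)
  next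
    case (step t)
    have "y < N + t" using fst_line_less[OF i] step.hyps by (simp add: y_def)
    then show ?case using step T[of t] assms by (simp add: pos_Suc)
  qed
  moreover obtain t where "pos t y = lim_pos y" "T \<le> t" using lim_pos2[of y y T] by metis
  ultimately show ?thesis by (metis rangeI)
qed

text \<open>By injectivity the range is infinite, and an infinite downward closed set of numbers
  contains them all.\<close>

lemma bij_lim_pos: "bij lim_pos"
proof -
  have "n \<in> range lim_pos" for n
  proof -
    have "infinite (range lim_pos)" using inj_lim_pos finite_imageD by blast
    then obtain x where "n < lim_pos x" by (metis finite_nat_set_iff_bounded_le not_le rangeE)
    then show ?thesis by (rule lim_pos_downward)
  qed
  then show ?thesis using inj_lim_pos by (auto simp: bij_def)
qed

lemma omega_iso_prec: "omega_iso (inv lim_pos) prec"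
  unfolding omega_iso_def prec_iff
  using bij_lim_pos bij_imp_bij_inv surj_f_inv_f[OF bij_is_surj[OF bij_lim_pos]] by simp

text \<open>Otherwise the last element would be pushed upwards for ever.\<close>

lemma append_unbounded: "\<exists>t\<ge>T. ins t = N + t"
proof (rule ccontr)
  assume "\<not> ?thesis"
  then have less: "ins t < N + t" if "T \<le> t" for t
    using ins_le[of t] that by (auto simp: le_less)
  define z where "z = fst (line (Suc T) ! (N + T))"
  have z: "z < N + Suc T" unfolding z_def by (rule fst_line_less) simp
  have pos: "Suc (pos t z) = N + t" if "Suc T \<le> t" for t
    using that
  proof (induction t rule: dec_induct)
    case base
    then show ?case using pos_fst_line[of "N + T" "Suc T"] by (simp add: z_def)
  next
    case (step t)
    then show ?case using less[of t] z by (simp add: pos_Suc)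
  qed
  obtain t where "pos t z = lim_pos z" "lim_pos z < ins t" "Suc T \<le> t"
    using lim_pos2[of z z "Suc T"] by metis
  then show False using pos[of t] less[of t] by simp
qed

text \<open>\<open>count\<close> changes only when a coding element is appended, and then by one, so
  each value is used up by some append.\<close>

lemma coded: "\<exists>t. ins t = N + t \<and> count t = j"
proof -
  have next_append: "\<exists>s\<ge>t. ins s = N + s \<and> count s = count t" for t
  proof -
    define s where "s = (LEAST s. t \<le> s \<and> ins s = N + s)"
    have s: "t \<le> s \<and> ins s = N + s"
      using LeastI_ex[OF append_unbounded[of t]] unfolding s_def .
    have "count r = count t" if "t \<le> r" "r \<le> s" for r
      using that
    proof (induction r rule: dec_induct)
      case (step r)
      then have "ins r \<noteq> N + r"
        using not_less_Least[of r "\<lambda>s. t \<le> s \<and> ins s = N + s"] unfolding s_def[symmetric] by auto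
      then show ?case using step ins_le[of r] by (simp add: count_Suc)
    qed simp
    then show ?thesis using s by blast
  qed
  show ?thesis
  proof (induction j)
    case 0
    have "count 0 = 0" by (simp add: count_def)
    then show ?case using next_append[of 0] by auto
  next
    case (Suc j)
    then obtain t where "ins t = N + t" "count t = j" by blast
    then have "count (Suc t) = Suc j" by (simp add: count_Suc)
    then show ?case using next_append[of "Suc t"] by auto
  qed
qed

text \<open>The element \<open>a_j\<close>; stage \<open>t\<close> creates the element
  \<open>N + t\<close>.\<close>

definition coder :: "nat \<Rightarrow> nat" where
  "coder j = N + (LEAST t. ins t = N + t \<and> count t = j)"

lemma f_coder: "f (lim_pos (coder j)) = c \<longleftrightarrow> j \<in> D"
proof -
  have "entry_of (coder j) = (coder j, j, c, d)"
    using LeastI_ex[OF coded[of j]] unfolding coder_def entry_of_new by (simp add: new_def)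
  then show ?thesis using c_neq_d by (simp add: f_lim_pos colour_def)
qed

end

section \<open>Computability of the construction\<close>

locale computable_coding_copy = coding_copy +
  assumes recursive_f: "recursive {} f"
    and recursive_h: "recursive {} (\<lambda>z. h (fst z) (snd z))"
begin

lemma recursive_f' [recursive_intros]:
  "recursive {} p \<Longrightarrow> recursive {} (\<lambda>x. f (p x))"
  by (rule recursive_compose[OF recursive_f])

lemma recursive_h' [recursive_intros]:
  "recursive {} p \<Longrightarrow> recursive {} q \<Longrightarrow> recursive {} (\<lambda>x. h (p x) (q x))"
  by (rule recursive_compose2[OF recursive_h])

lemma recursive_gap [recursive_intros]:
  assumes "recursive {} p" "recursive {} q"
  shows "recursive {} (\<lambda>x. gap (p x) (q x))"
proof -
  \<comment> \<open>\<open>hd (drop i xs)\<close> is recursive for every \<open>i\<close> and can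
    differ from \<open>xs ! i\<close> only where the first disjunct already holds.\<close>
  have "gap t xs = (LEAST i. length xs \<le> i \<or> f i \<noteq> stage_colour t (hd (drop i xs)))" for t xs
    unfolding gap_def by (intro arg_cong[where f = Least] ext disj_cong) (simp_all add: hd_drop_conv_nth)
  moreover have "recursive {} (\<lambda>z. LEAST i. length (snd z) \<le> i \<or>
      f i \<noteq> stage_colour (fst z) (hd (drop i (snd z))))"
    unfolding colour_def by (intro recursive_intros) auto
  ultimately show ?thesis using recursive_compose2[OF _ assms, of gap] by simp
qed

lemma recursive_state: "recursive {} state"
proof -
  have "state t = rec_nat (0, map (\<lambda>i. (i, 0, f i, f i)) [0..<N]) step t" for t
    by (induction t) simp_all
  moreover have "recursive {} (\<lambda>t. rec_nat (0, map (\<lambda>i. (i, 0, f i, f i)) [0..<N]) step t)"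
    unfolding step_def by (intro recursive_intros)
  ultimately show ?thesis by presburger
qed

lemma recursive_line [recursive_intros]:
  "recursive {} p \<Longrightarrow> recursive {} (\<lambda>x. line (p x))"
  unfolding line_def by (intro recursive_intros recursive_compose[OF recursive_state])

lemma recursive_count [recursive_intros]:
  "recursive {} p \<Longrightarrow> recursive {} (\<lambda>x. count (p x))"
  unfolding count_def by (intro recursive_intros recursive_compose[OF recursive_state])

lemma recursive_ins [recursive_intros]:
  "recursive {} p \<Longrightarrow> recursive {} (\<lambda>x. ins (p x))"
  unfolding ins_def by (intro recursive_intros)

lemma recursive_pos [recursive_intros]:
  assumes "recursive {} p" "recursive {} q"
  shows "recursive {} (\<lambda>x. pos (p x) (q x))"
proof -
  have "pos t x = (LEAST i. N + t \<le> i \<or> fst (hd (drop i (line t))) = x)" for t x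
    unfolding pos_def
    by (intro arg_cong[where f = Least] ext disj_cong) (simp_all add: hd_drop_conv_nth)
  moreover have "recursive {} (\<lambda>z. LEAST i. N + fst z \<le> i \<or> fst (hd (drop i (line (fst z)))) = snd z)"
    by (intro recursive_intros) auto
  ultimately show ?thesis using recursive_compose2[OF _ assms, of pos] by simp
qed

lemma computable_copy_prec: "computable_copy prec"
  unfolding computable_copy_def computable_rel2_iff prec_def[abs_def]
  using omega_iso_prec by (auto intro!: recursive_intros simp: prec_def[abs_def])

lemma recursive_entry_of: "recursive {} entry_of"
proof -
  have "pos (Suc x) x < length (line (Suc x))" for x
    using pos_less[of x "Suc x"] by simp
  then show ?thesis
    unfolding entry_of_def[abs_def] by (intro recursive_nth recursive_intros)
qed

lemma recursive_coder: "recursive {} coder"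
  unfolding coder_def by (intro recursive_intros coded)

text \<open>The entry of \<open>x\<close> is computable, and its final colour takes one question to
  \<open>D\<close>.\<close>

lemma recursive_f_lim_pos: "recursive D (\<lambda>x. f (lim_pos x))"
  unfolding f_lim_pos colour_def
  by (intro recursive_intros recursive_compose[OF recursive_member_oracle]
      recursive_oracle_empty[OF recursive_entry_of])

end

subsection \<open>Degrees of graphs\<close>

lemma mem_graph_in_copy:
  assumes "omega_iso \<phi> R"
  shows "z \<in> prod_encode ` graph_in_copy f R \<longleftrightarrow>
    snd (prod_decode z) = \<phi> (f (inv \<phi> (fst (prod_decode z))))"
proof -
  obtain x y where z: "z = prod_encode (x, y)" by (metis prod.collapse prod_decode_inverse)
  have "bij \<phi>" using assms by (simp add: omega_iso_def)
  then have "(x, y) \<in> graph_in_copy f R \<longleftrightarrow> y = \<phi> (f (inv \<phi> x))"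
    unfolding graph_in_copy_def fun_graph_def copy_iso_eq[OF assms]
    by (auto simp: bij_is_inj bij_is_surj surj_f_inv_f image_iff)
      (metis bij_is_surj surj_f_inv_f)
  then show ?thesis unfolding z by (simp add: inj_image_mem_iff[OF inj_prod_encode])
qed

lemma graph_in_copy_reducible:
  assumes iso: "omega_iso \<phi> R" and fin: "finite (range f)"
    and rec: "recursive A (\<lambda>x. f (inv \<phi> x))"
  shows "prod_encode ` graph_in_copy f R \<le>\<^sub>T A"
proof -
  \<comment> \<open>\<open>\<phi>\<close> may be noncomputable, but it is applied only to values of
    \<open>f\<close>; on this finite set a table replaces it, with default \<open>0\<close>
    elsewhere.\<close>
  define F where "F v = (if v \<in> range f then \<phi> v else 0)" for v
  have "recursive A F"
    by (rule recursive_almost_const[of _ 0]) (auto simp: F_def intro: finite_subset[OF _ fin])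
  then have "recursive A (\<lambda>z. snd (prod_decode z) = F (f (inv \<phi> (fst (prod_decode z)))))"
    by (intro recursive_eq recursive_snd_decode recursive_compose[OF _ recursive_compose[OF rec]]
        recursive_fst_decode)
  then show ?thesis
    unfolding turing_reducible_iff mem_graph_in_copy[OF iso] F_def by simp
qed

lemma Delta2_graph_in_copy:
  assumes f: "computable_fun f" and R: "computable_copy R"
  shows "Delta2 (prod_encode ` graph_in_copy f R)"
proof -
  obtain \<phi> where iso: "omega_iso \<phi> R" using R unfolding computable_copy_def by blast
  then have bij: "bij \<phi>" by (simp add: omega_iso_def)
  \<comment> \<open>Counts the predecessors of \<open>x\<close> among the numbers below
    \<open>s\<close>; in the limit this is the position of \<open>x\<close>.\<close>
  define g where "g x s = rec_nat 0 (\<lambda>w r. if R w x then Suc r else r) s" for x s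
  have g_card: "g x s = card {w. w < s \<and> R w x}" for x s
  proof (induction s)
    case (Suc s)
    have "{w. w < Suc s \<and> R w x} =
        (if R s x then insert s {w. w < s \<and> R w x} else {w. w < s \<and> R w x})"
      by (auto simp: less_Suc_eq)
    then show ?case using Suc by (simp add: g_def)
  qed (simp add: g_def)
  have lim: "\<forall>\<^sub>F s in sequentially. g x s = inv \<phi> x" for x
  proof -
    have inv: "\<phi> (inv \<phi> w) = w" "inv \<phi> (\<phi> n) = n" for w n
      using bij by (simp_all add: bij_is_surj surj_f_inv_f bij_is_inj)
    have less_iff: "R w x \<longleftrightarrow> inv \<phi> w < inv \<phi> x" for w
      using iso unfolding omega_iso_def by (metis inv(1))
    have pred: "{w. R w x} = \<phi> ` {..<inv \<phi> x}"
    proof (intro equalityI subsetI)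
      fix w assume "w \<in> {w. R w x}"
      then show "w \<in> \<phi> ` {..<inv \<phi> x}"
        by (intro image_eqI[of _ _ "inv \<phi> w"]) (simp_all add: inv less_iff)
    qed (auto simp: inv less_iff)
    then have fin: "finite {w. R w x}" by simp
    have "g x s = inv \<phi> x" if "Suc (Max {w. R w x}) \<le> s" for s
    proof -
      have "{w. w < s \<and> R w x} = {w. R w x}"
        using Max_ge[OF fin] that by (auto simp: Suc_le_eq intro: le_less_trans)
      then show ?thesis
        unfolding g_card pred
        by (simp add: card_image inj_on_subset[OF bij_is_inj[OF bij] subset_UNIV])
    qed
    then show ?thesis unfolding eventually_sequentially by blast
  qed
  have R': "recursive {} (\<lambda>z. R (fst z) (snd z))"
    using R unfolding computable_copy_def computable_rel2_iff by blast
  have g: "recursive {} (\<lambda>z. g (fst z) (snd z))"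
    unfolding g_def by (intro recursive_intros recursive_compose2[OF R'])
  \<comment> \<open>Membership of \<open>(x, y)\<close> is expressed by positions: \<open>f\<close>
    maps the position of \<open>x\<close> to that of \<open>y\<close>, and both are limits of
    \<open>g\<close>.\<close>
  have "recursive {} (\<lambda>z. f (g (fst (prod_decode (fst z))) (snd z)) =
      g (snd (prod_decode (fst z))) (snd z))"
    by (intro recursive_eq recursive_compose[OF f[unfolded computable_fun_iff]]
        recursive_compose2[OF g] recursive_compose[OF recursive_fst_decode]
        recursive_compose[OF recursive_snd_decode] recursive_fst recursive_snd recursive_id)
  then show ?thesis
  proof (rule Delta2_of_limit)
    fix z
    let ?x = "fst (prod_decode z)" and ?y = "snd (prod_decode z)"
    have "f (inv \<phi> ?x) = inv \<phi> ?y \<longleftrightarrow> z \<in> prod_encode ` graph_in_copy f R"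
      unfolding mem_graph_in_copy[OF iso]
      using bij by (metis bij_inv_eq_iff)
    then show "\<forall>\<^sub>F s in sequentially. f (g ?x s) = g ?y s \<longleftrightarrow> z \<in> prod_encode ` graph_in_copy f R"
      using eventually_conj[OF lim[of ?x] lim[of ?y]] by (auto elim!: eventually_mono)
  qed
qed

text \<open>In any copy only finitely many elements have a colour other than \<open>v\<close>, so
  the colouring is computable. The contrapositive provides two recurring colours.\<close>

lemma eventually_const_intrinsically_computable:
  assumes const: "\<And>n. N \<le> n \<Longrightarrow> f n = v"
  shows "intrinsically_computable f"
proof -
  have "range f \<subseteq> insert v (f ` {..<N})" using const by (force simp: not_less[symmetric])
  then have fin: "finite (range f)" by (rule finite_subset) simp
  have deg: "turing_degree (prod_encode ` graph_in_copy f R) = computable_degree"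
    if "omega_iso \<phi> R" for R \<phi>
  proof -
    have "x \<in> \<phi> ` {..<N}" if "f (inv \<phi> x) \<noteq> v" for x
    proof -
      have "inv \<phi> x < N" using that const not_le by blast
      moreover have "\<phi> (inv \<phi> x) = x"
        using \<open>omega_iso \<phi> R\<close> by (simp add: omega_iso_def bij_is_surj surj_f_inv_f)
      ultimately show ?thesis by (metis imageI lessThan_iff)
    qed
    then have "{x. f (inv \<phi> x) \<noteq> v} \<subseteq> \<phi> ` {..<N}" by blast
    then have "finite {x. f (inv \<phi> x) \<noteq> v}" by (rule finite_subset) simp
    then have "prod_encode ` graph_in_copy f R \<le>\<^sub>T {}"
      by (intro graph_in_copy_reducible[OF that fin] recursive_almost_const)
    moreover have "{} \<le>\<^sub>T B" for B
      unfolding turing_reducible_iff by (simp add: recursive_const)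
    ultimately show ?thesis
      unfolding computable_degree_def turing_degree_eq_iff turing_equiv_def by blast
  qed
  \<comment> \<open>The standard order shows that the spectrum is nonempty.\<close>
  have "computable_copy (<)"
    unfolding computable_copy_def computable_rel2_iff
    by (auto intro!: recursive_intros exI[of _ id] simp: omega_iso_def)
  then show ?thesis
    unfolding intrinsically_computable_def degree_spectrum_def
    using deg unfolding computable_copy_def by auto
qed

text \<open>Finitely many values, each taken finitely often, occupy a bounded set of positions;
  \<open>N\<close> lies beyond it.\<close>

lemma finite_range_recurring:
  fixes f :: "nat \<Rightarrow> nat"
  assumes "finite (range f)"
  obtains N where "\<And>n m. N \<le> n \<Longrightarrow> \<exists>k\<ge>m. f k = f n"
proof -
  let ?B = "{v \<in> range f. finite (f -` {v})}"
  have "finite (\<Union>v\<in>?B. f -` {v})" using assms by auto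
  then obtain N where N: "\<forall>n\<in>(\<Union>v\<in>?B. f -` {v}). n < N"
    unfolding finite_nat_set_iff_bounded by blast
  have "\<exists>k\<ge>m. f k = f n" if "N \<le> n" for n m
  proof -
    have "infinite (f -` {f n})" using N that by (auto simp: not_less[symmetric])
    then show ?thesis
      unfolding finite_nat_set_iff_bounded by (auto simp: not_less)
  qed
  then show ?thesis using that by blast
qed

theorem theorem2:
  fixes f :: "nat \<Rightarrow> nat"
  assumes "computable_fun f"
    and "finite (range f)"
    and "\<not> intrinsically_computable f"
  shows "degree_spectrum f = Delta2_degrees"
proof
  show "degree_spectrum f \<subseteq> Delta2_degrees"
    unfolding degree_spectrum_def Delta2_degrees_def
    using Delta2_graph_in_copy[OF assms(1)] by blast
  obtain N where N: "\<And>n m. N \<le> n \<Longrightarrow> \<exists>k\<ge>m. f k = f n"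
    using finite_range_recurring[OF assms(2)] by blast
  \<comment> \<open>Both positions are at least \<open>N\<close>, so \<open>f N\<close> and
    \<open>f n\<close> recur; they serve as \<open>c\<close> and \<open>d\<close>.\<close>
  obtain n where n: "N \<le> n" "f n \<noteq> f N"
    using eventually_const_intrinsically_computable[of N f "f N"] assms(3) by blast
  show "Delta2_degrees \<subseteq> degree_spectrum f"
  proof
    fix a assume "a \<in> Delta2_degrees"
    then obtain D where a: "a = turing_degree D" and "Delta2 D"
      unfolding Delta2_degrees_def by blast
    then obtain h where h: "recursive {} (\<lambda>z. h (fst z) (snd z))"
      "\<And>x. \<forall>\<^sub>F t in sequentially. h x t \<longleftrightarrow> x \<in> D"
      using limit_of_Delta2 by blast
    interpret computable_coding_copy f h D "f N" "f n" N
      using N n h assms(1) by unfold_locales (auto simp: computable_fun_iff)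
    define G where "G = prod_encode ` graph_in_copy f prec"
    have "G \<le>\<^sub>T D"
      unfolding G_def using recursive_f_lim_pos
      by (intro graph_in_copy_reducible[OF omega_iso_prec assms(2)])
        (simp add: inv_inv_eq bij_lim_pos)
    moreover have "D \<le>\<^sub>T G"
    proof -
      \<comment> \<open>The graph contains this pair exactly when \<open>coder j\<close> has colour
        \<open>f N\<close>; the second component is one fixed element of the copy, hence a
        constant.\<close>
      have "j \<in> D \<longleftrightarrow> prod_encode (coder j, inv lim_pos (f N)) \<in> G" for j
        unfolding G_def mem_graph_in_copy[OF omega_iso_prec] f_coder[symmetric]
        using bij_lim_pos by (auto simp: inv_inv_eq bij_is_surj inj_eq bij_imp_bij_inv bij_is_inj)
      moreover have "recursive G (\<lambda>j. prod_encode (coder j, inv lim_pos (f N)) \<in> G)"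
        by (intro recursive_compose[OF recursive_member_oracle] recursive_prod_encode
            recursive_oracle_empty[OF recursive_coder] recursive_const)
      ultimately show ?thesis unfolding turing_reducible_iff by simp
    qed
    ultimately have "turing_degree G = a"
      unfolding a turing_degree_eq_iff turing_equiv_def by blast
    then show "a \<in> degree_spectrum f"
      unfolding degree_spectrum_def G_def using computable_copy_prec by blast
  qed
qed

end
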